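(* Let $\mathbb{D}$ be the unit disk or the complex plane, $y:\mathbb{D}\to S^{n+2}$ a Willmore surface and $z_0\in\mathbb{D}$ a base point. Let $(\mu,S)$ be an orientation reversing symmetry of the harmonic conformal Gauss map $f:\mathbb{D}\to SO^+(1,n+3)/(SO^+(1,3)\times SO(n))$ of $y$. Let $F(z,\bar z,\lambda)$ be the extended frame of $f$ satisfying $F(z_0,\bar z_0,\lambda)=I$. Then: (1) There exist some $M(\lambda)\in\Lambda O^+(1,n+3)_\sigma$ and $k(z,\bar z)\in O^+(1,3)\times O(n)$ such that $$F(\mu(z),\overline{\mu(z)},\lambda)=M(\lambda)\cdot F(z,\bar z,\lambda^{-1})\cdot k(z,\bar z).$$ Here $k=\mathrm{diag}(k_1,k_2)$ is block diagonal and independent of $\lambda$, with $k_1\in O^+(1,3)$, $k_2\in O(n)$, $\det k_1=-1$ and $\det k_2=-\det\hat S$. Moreover $\hat S=M(\lambda=1)$, and $k_1$ has the explicit representation $$k_1=\begin{pmatrix}\frac{e^{\tau}+e^{-\tau}(a^2+b^2+1)}2&\frac{-e^{\tau}+e^{-\tau}(a^2+b^2+1)}2&-a\cos\theta-b\sin\theta&-a\sin\theta+b\cos\theta\\ \frac{-e^{\tau}-e^{-\tau}(a^2+b^2-1)}2&\frac{e^{\tau}-e^{-\tau}(a^2+b^2-1)}2&a\cos\theta+b\sin\theta&a\sin\theta-b\cos\theta\\-ae^{-\tau}&-ae^{-\tau}&\cos\theta&\sin\theta\\-be^{-\tau}&-be^{-\tau}&\sin\theta&-\cos\theta\end{pmatrix},$$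 where $\frac{\partial\mu}{\partial\bar z}=e^{\tau+i\theta}$ with $\tau,\theta$ real valued, $a=-\mathrm{Re}(\sqrt2\,\tau_z)$, $b=\mathrm{Im}(\sqrt2\,\tau_z)$. (2) For the associated family $f(z,\bar z,\lambda)$ one has $$f(\mu(z),\overline{\mu(z)},\lambda)=M(\lambda)\,f(z,\bar z,\lambda^{-1})^\star .$$
   Context: $\mathbb{R}^{n+4}_1$ is $\mathbb{R}^{n+4}$ with its standard orientation and $\langle x,y\rangle=x^tI_{1,n+3}y$, $I_{1,n+3}=\mathrm{diag}(-1,1,\dots,1)$; $S^{n+2}$ is identified with the projectivized forward light cone by $x\mapsto[(1,x)]$. $O^+(1,n+3)$: $I_{1,n+3}$-orthogonal real matrices preserving the forward light cone (every conformal diffeomorphism $S$ of $S^{n+2}$ is induced by a unique $\hat S\in O^+(1,n+3)$); $SO^+(1,n+3)$: those of determinant one. Conformal Gauss map and frame. For a conformal immersion $y$ with coordinate $z$, the canonical lift $Y$ is the forward light-cone valued map with $[Y]=y$, $\langle Y_z,Y_{\bar z}\rangle=\frac12$. Put $Y_z=\frac12(e_1-ie_2)$; $N$ is the section of $V=\mathrm{Span}_{\mathbb R}\{Y,\mathrm{Re}Y_z,\mathrm{Im}Y_z,Y_{z\bar z}\}$ with $\langle N,Y_z\rangle=\langle N,N\rangle=0$, $\langle N,Y\rangle=-1$; $e_0=\frac1{\sqrt2}(Y+N)$, $\hat e_0=\frac1{\sqrt2}(-Y+N)$. The oriented conformal Gauss map $f$ is $p\mapsto V_p$, oriented by $(e_0,\hat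 e_0,e_1,e_2)$, with values in the space $SO^+(1,n+3)/K$, $K=SO^+(1,3)\times SO(n)$, of oriented 4-dimensional Lorentzian subspaces; $^\star$ reverses the orientation of such a subspace. $O^+(1,n+3)$ acts on oriented subspaces. $y$ is Willmore iff $f$ is harmonic. The frame of $f$ is $F=(e_0,\hat e_0,e_1,e_2,\psi_1,\dots,\psi_n)\in SO^+(1,n+3)$ with $\psi_j$ an orthonormal frame of $V^\perp$. Symmetry. An orientation reversing symmetry $(\mu,S)$ consists of an anti-holomorphic automorphism $\mu$ of $\mathbb{D}$ and a conformal diffeomorphism $S$ of $S^{n+2}$, mapping $y(\mathbb{D})$ onto itself, with $y(\mu(z))=S(y(z))$. Extended frame. $\sigma=\mathrm{Ad}(\mathrm{diag}(-I_4,I_n))$; $\mathfrak{so}(1,n+3)=\mathfrak k\oplus\mathfrak p$ the $(\pm1)$-eigenspace decomposition; $\alpha=F^{-1}dF=\alpha'_{\mathfrak p}+\alpha_{\mathfrak k}+\alpha''_{\mathfrak p}$ ($'$, $''$: $(1,0)$- and $(0,1)$-parts). The extended frame $F(z,\bar z,\lambda)$, $\lambda\in S^1$, solves $dF=F(\lambda^{-1}\alpha'_{\mathfrak p}+\alpha_{\mathfrak k}+\lambda\alpha''_{\mathfrak p})$ with $F(z_0,\bar z_0,\lambda)=I$ (and $F(\cdot,\lambda=1)=F$; the surface is normalized by a conformal transformation so that $F(z_0,\bar z_0)=I$). $f(z,\bar z,\lambda)=F(z,\bar z,\lambda)\bmod K$. $\Lambda O^+(1,n+3)_\sigma$ is the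 group of loops $\gamma:S^1\to O^+(1,n+3)$ with $\sigma\gamma(\lambda)=\gamma(-\lambda)$. *)

theory Defs
  imports "HOL-Analysis.Analysis"
begin

section \<open>Smooth maps and Wirtinger derivatives\<close>

fun Ck_map_on ::
  "nat \<Rightarrow> 'a::euclidean_space set \<Rightarrow> ('a \<Rightarrow> 'b::real_normed_vector) \<Rightarrow> bool" where
  "Ck_map_on 0 U g = continuous_on U g"
| "Ck_map_on (Suc k) U g =
     ((\<forall>x\<in>U. g differentiable (at x)) \<and>
      (\<forall>v. Ck_map_on k U (\<lambda>x. frechet_derivative g (at x) v)))"

text \<open>Only used for open domains.\<close>

definition smooth_map_on ::
  "'a::euclidean_space set \<Rightarrow> ('a \<Rightarrow> 'b::real_normed_vector) \<Rightarrow> bool" where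
  "smooth_map_on U g \<longleftrightarrow> (\<forall>k. Ck_map_on k U g)"

definition partial_x :: "(complex \<Rightarrow> 'b::real_normed_vector) \<Rightarrow> complex \<Rightarrow> 'b" where
  "partial_x g z = frechet_derivative g (at z) 1"

definition partial_y :: "(complex \<Rightarrow> 'b::real_normed_vector) \<Rightarrow> complex \<Rightarrow> 'b" where
  "partial_y g z = frechet_derivative g (at z) \<i>"

definition d_z :: "(complex \<Rightarrow> complex) \<Rightarrow> complex \<Rightarrow> complex" where
  "d_z g z = (partial_x g z - \<i> * partial_y g z) / 2"

definition d_zbar :: "(complex \<Rightarrow> complex) \<Rightarrow> complex \<Rightarrow> complex" where
  "d_zbar g z = (partial_x g z + \<i> * partial_y g z) / 2"

definition vd_z :: "(complex \<Rightarrow> complex ^ 'm) \<Rightarrow> complex \<Rightarrow> complex ^ 'm" where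
  "vd_z Y z = (\<chi> i. d_z (\<lambda>p. Y p $ i) z)"

definition vd_zbar :: "(complex \<Rightarrow> complex ^ 'm) \<Rightarrow> complex \<Rightarrow> complex ^ 'm" where
  "vd_zbar Y z = (\<chi> i. d_zbar (\<lambda>p. Y p $ i) z)"

definition cvec :: "real ^ 'm \<Rightarrow> complex ^ 'm" where
  "cvec x = (\<chi> i. complex_of_real (x $ i))"

definition Re_vec :: "complex ^ 'm \<Rightarrow> real ^ 'm" where
  "Re_vec x = (\<chi> i. Re (x $ i))"

definition Im_vec :: "complex ^ 'm \<Rightarrow> real ^ 'm" where
  "Im_vec x = (\<chi> i. Im (x $ i))"

definition cmat :: "real ^ 'm ^ 'k \<Rightarrow> complex ^ 'm ^ 'k" where
  "cmat = map_matrix complex_of_real"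

definition cscale :: "complex \<Rightarrow> complex ^ 'm ^ 'k \<Rightarrow> complex ^ 'm ^ 'k" where
  "cscale c = map_matrix ((*) c)"


section \<open>Lorentzian linear algebra\<close>

text \<open>
  The coordinates of \<open>\<real>\<^sup>n\<^sup>+\<^sup>4\<close> are indexed by the sum type \<^typ>\<open>4 + 'n\<close> with \<open>n = CARD('n)\<close>:
  \<open>Inl 1, Inl 2, Inl 3, Inl 4\<close> are the first four coordinates (in the numeral type \<^typ>\<open>4\<close> one
  has \<open>4 = 0\<close>), \<open>Inr j\<close> the remaining \<open>n\<close>. The parameter \<open>t\<close> below is the timelike index; it is
  \<open>Inl 1\<close> for \<open>\<real>\<^sup>n\<^sup>+\<^sup>4\<close> and \<open>1\<close> for \<open>\<real>\<^sup>4\<close>.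
\<close>

definition minkowski :: "'m::finite \<Rightarrow> 'a::comm_ring_1 ^ 'm ^ 'm" where
  "minkowski t = (\<chi> i j. if i = j then (if i = t then - 1 else 1) else 0)"

definition lor :: "'m::finite \<Rightarrow> 'a::comm_ring_1 ^ 'm \<Rightarrow> 'a ^ 'm \<Rightarrow> 'a" where
  "lor t x y = (\<Sum>i\<in>UNIV. x $ i * (minkowski t *v y) $ i)"

definition forward_cone :: "'m::finite \<Rightarrow> (real ^ 'm) set" where
  "forward_cone t = {x. lor t x x = 0 \<and> x $ t > 0}"

definition O_plus :: "'m::finite \<Rightarrow> (real ^ 'm ^ 'm) set" where
  "O_plus t = {A. transpose A ** minkowski t ** A = minkowski t \<and>
                  (\<forall>x\<in>forward_cone t. A *v x \<in> forward_cone t)}"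

definition SO_plus :: "'m::finite \<Rightarrow> (real ^ 'm ^ 'm) set" where
  "SO_plus t = {A \<in> O_plus t. det A = 1}"

definition blockdiag ::
  "'a::zero ^ 4 ^ 4 \<Rightarrow> 'a ^ 'n ^ 'n \<Rightarrow> 'a ^ (4 + 'n::finite) ^ (4 + 'n)" where
  "blockdiag A B = (\<chi> i j. case i of
      Inl p \<Rightarrow> (case j of Inl q \<Rightarrow> A $ p $ q | Inr q \<Rightarrow> 0)
    | Inr p \<Rightarrow> (case j of Inl q \<Rightarrow> 0 | Inr q \<Rightarrow> B $ p $ q))"

definition sigma :: "real ^ (4 + 'n::finite) ^ (4 + 'n) \<Rightarrow> real ^ (4 + 'n) ^ (4 + 'n)" where
  "sigma X = blockdiag (- mat 1) (mat 1) ** X ** matrix_inv (blockdiag (- mat 1) (mat 1))"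

text \<open>The components of \<open>X\<close> in the eigenspaces of \<^const>\<open>sigma\<close> for \<open>1\<close> and \<open>-1\<close>.\<close>

definition k_part :: "real ^ (4 + 'n::finite) ^ (4 + 'n) \<Rightarrow> real ^ (4 + 'n) ^ (4 + 'n)" where
  "k_part X = (1/2) *\<^sub>R (X + sigma X)"

definition p_part :: "real ^ (4 + 'n::finite) ^ (4 + 'n) \<Rightarrow> real ^ (4 + 'n) ^ (4 + 'n)" where
  "p_part X = (1/2) *\<^sub>R (X - sigma X)"

definition twisted_loops :: "(complex \<Rightarrow> real ^ (4 + 'n::finite) ^ (4 + 'n)) set" where
  "twisted_loops = {\<gamma>. continuous_on (sphere 0 1) \<gamma> \<and>
     (\<forall>lam\<in>sphere 0 1. \<gamma> lam \<in> O_plus (Inl 1) \<and> sigma (\<gamma> lam) = \<gamma> (- lam))}"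


section \<open>Oriented four-dimensional subspaces\<close>

text \<open>
  An ordered basis of a four-dimensional subspace of \<open>\<real>\<^sup>n\<^sup>+\<^sup>4\<close> is the matrix with the basis vectors
  as columns, and an oriented subspace is the set of its positively oriented bases. The coset
  of \<open>A\<close> modulo \<open>SO\<^sup>+(1,3) \<times> SO(n)\<close> is the span of the first four columns of \<open>A\<close>, oriented by
  these columns.
\<close>

type_synonym 'n basis4 = "real ^ 4 ^ (4 + 'n)"

definition oriented_span :: "('n::finite) basis4 \<Rightarrow> 'n basis4 set" where
  "oriented_span B = {B ** A | A :: real ^ 4 ^ 4. det A > 0}"

definition reverse_orientation :: "('n::finite) basis4 set \<Rightarrow> 'n basis4 set" where
  "reverse_orientation W = {B ** A | B (A :: real ^ 4 ^ 4). B \<in> W \<and> det A < 0}"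

definition act_oriented ::
  "real ^ (4 + 'n::finite) ^ (4 + 'n) \<Rightarrow> 'n basis4 set \<Rightarrow> 'n basis4 set" where
  "act_oriented M W = (\<lambda>B. M ** B) ` W"

definition first_four :: "real ^ (4 + 'n::finite) ^ (4 + 'n) \<Rightarrow> 'n basis4" where
  "first_four A = (\<chi> i j. A $ i $ Inl j)"

definition mod_K :: "real ^ (4 + 'n::finite) ^ (4 + 'n) \<Rightarrow> 'n basis4 set" where
  "mod_K A = oriented_span (first_four A)"


section \<open>Conformal geometry of the sphere\<close>

text \<open>The vector \<open>(1, x)\<close>; \<open>\<real>\<^sup>n\<^sup>+\<^sup>3\<close> is indexed by \<^typ>\<open>3 + 'n\<close>.\<close>

definition cone_point :: "real ^ (3 + 'n::finite) \<Rightarrow> real ^ (4 + 'n)" where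
  "cone_point x = (\<chi> i. case i of
      Inl p \<Rightarrow> (if p = 1 then 1 else if p = 2 then x $ Inl 1
               else if p = 3 then x $ Inl 2 else x $ Inl 3)
    | Inr q \<Rightarrow> x $ Inr q)"

definition proj_eq :: "real ^ 'm \<Rightarrow> real ^ 'm \<Rightarrow> bool" where
  "proj_eq u v \<longleftrightarrow> (\<exists>c. c \<noteq> 0 \<and> u = c *\<^sub>R v)"

text \<open>
  Smoothness and differential of a map on the unit sphere are those of its extension that is
  constant on rays; the differential is evaluated on tangent vectors only.
\<close>

definition radial_ext :: "('a::euclidean_space \<Rightarrow> 'b) \<Rightarrow> 'a \<Rightarrow> 'b" where
  "radial_ext S x = S (x /\<^sub>R norm x)"

definition conformal_diffeo :: "('a::euclidean_space \<Rightarrow> 'a) \<Rightarrow> bool" where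
  "conformal_diffeo S \<longleftrightarrow>
     bij_betw S (sphere 0 1) (sphere 0 1) \<and>
     smooth_map_on (- {0}) (radial_ext S) \<and>
     smooth_map_on (- {0}) (radial_ext (inv_into (sphere 0 1) S)) \<and>
     (\<forall>x\<in>sphere 0 1. \<exists>r>0. \<forall>u v. u \<bullet> x = 0 \<longrightarrow> v \<bullet> x = 0 \<longrightarrow>
        frechet_derivative (radial_ext S) (at x) u \<bullet>
        frechet_derivative (radial_ext S) (at x) v = r * (u \<bullet> v))"

definition induces ::
  "real ^ (4 + 'n::finite) ^ (4 + 'n) \<Rightarrow> (real ^ (3 + 'n) \<Rightarrow> real ^ (3 + 'n)) \<Rightarrow> bool" where
  "induces A S \<longleftrightarrow>
     (\<forall>x\<in>sphere 0 1. proj_eq (A *v cone_point x) (cone_point (S x)))"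

definition conformal_immersion ::
  "complex set \<Rightarrow> (complex \<Rightarrow> real ^ (3 + 'n::finite)) \<Rightarrow> bool" where
  "conformal_immersion D y \<longleftrightarrow>
     smooth_map_on D y \<and>
     (\<forall>z\<in>D. y z \<in> sphere 0 1 \<and>
        partial_x y z \<noteq> 0 \<and> norm (partial_x y z) = norm (partial_y y z) \<and>
        partial_x y z \<bullet> partial_y y z = 0)"


section \<open>The conformal Gauss map and its frames\<close>

definition canonical_lift ::
  "complex set \<Rightarrow> (complex \<Rightarrow> real ^ (3 + 'n::finite)) \<Rightarrow>
   (complex \<Rightarrow> real ^ (4 + 'n)) \<Rightarrow> bool" where
  "canonical_lift D y Y \<longleftrightarrow>
     smooth_map_on D Y \<and>
     (\<forall>z\<in>D. Y z \<in> forward_cone (Inl 1) \<and> proj_eq (Y z) (cone_point (y z)) \<and>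
        lor (Inl 1) (vd_z (\<lambda>p. cvec (Y p)) z) (vd_zbar (\<lambda>p. cvec (Y p)) z) = 1/2)"

definition gauss_space ::
  "(complex \<Rightarrow> real ^ (4 + 'n::finite)) \<Rightarrow> complex \<Rightarrow> (real ^ (4 + 'n)) set" where
  "gauss_space Y z =
     span {Y z, Re_vec (vd_z (\<lambda>p. cvec (Y p)) z), Im_vec (vd_z (\<lambda>p. cvec (Y p)) z),
           Re_vec (vd_zbar (vd_z (\<lambda>p. cvec (Y p))) z)}"

text \<open>
  The columns of \<open>E z\<close> are \<open>e\<^sub>0 = (Y + N)/\<surd>2\<close>, its companion \<open>(- Y + N)/\<surd>2\<close>, \<open>e\<^sub>1\<close> and \<open>e\<^sub>2\<close>.
\<close>

definition gauss_basis ::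
  "complex set \<Rightarrow> (complex \<Rightarrow> real ^ (3 + 'n::finite)) \<Rightarrow>
   (complex \<Rightarrow> 'n basis4) \<Rightarrow> bool" where
  "gauss_basis D y E \<longleftrightarrow>
     (\<exists>Y N. canonical_lift D y Y \<and>
       (\<forall>z\<in>D.
          N z \<in> gauss_space Y z \<and>
          lor (Inl 1) (cvec (N z)) (vd_z (\<lambda>p. cvec (Y p)) z) = 0 \<and>
          lor (Inl 1) (N z) (N z) = 0 \<and> lor (Inl 1) (N z) (Y z) = - 1 \<and>
          column 1 (E z) = (1 / sqrt 2) *\<^sub>R (Y z + N z) \<and>
          column 2 (E z) = (1 / sqrt 2) *\<^sub>R (- Y z + N z) \<and>
          vd_z (\<lambda>p. cvec (Y p)) z =
            (1/2) *s (cvec (column 3 (E z)) - \<i> *s cvec (column 4 (E z)))))"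

definition conformal_gauss_map ::
  "complex set \<Rightarrow> (complex \<Rightarrow> real ^ (3 + 'n::finite)) \<Rightarrow>
   (complex \<Rightarrow> 'n basis4 set) \<Rightarrow> bool" where
  "conformal_gauss_map D y f \<longleftrightarrow>
     (\<exists>E. gauss_basis D y E \<and> (\<forall>z\<in>D. f z = oriented_span (E z)))"

text \<open>
  The last \<open>n\<close> columns \<open>\<psi>\<^sub>j\<close> of \<open>F z\<close> are an orthonormal frame of the orthogonal complement of
  the first four because \<open>F z \<in> SO\<^sup>+(1,n+3)\<close>.
\<close>

definition gauss_frame ::
  "complex set \<Rightarrow> (complex \<Rightarrow> real ^ (3 + 'n::finite)) \<Rightarrow>
   (complex \<Rightarrow> real ^ (4 + 'n) ^ (4 + 'n)) \<Rightarrow> bool" where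
  "gauss_frame D y F \<longleftrightarrow>
     smooth_map_on D F \<and> (\<forall>z\<in>D. F z \<in> SO_plus (Inl 1)) \<and>
     gauss_basis D y (\<lambda>z. first_four (F z))"

definition maurer_cartan ::
  "(complex \<Rightarrow> real ^ 'm ^ 'm::finite) \<Rightarrow> complex \<Rightarrow> complex \<Rightarrow> real ^ 'm ^ 'm" where
  "maurer_cartan F z v = matrix_inv (F z) ** frechet_derivative F (at z) v"

text \<open>
  Harmonicity of a map \<open>f = F mod K\<close> into the symmetric space is the vanishing of the tension field
  \<open>\<nabla>\<^sub>x f\<^sub>x + \<nabla>\<^sub>y f\<^sub>y\<close>. A frame \<open>F\<close> identifies \<open>df(v)\<close> with \<open>\<alpha>\<^sub>\<pp>(v)\<close> and the Levi-Civita
  derivative \<open>\<nabla>\<^sub>v\<close> with \<open>\<partial>\<^sub>v + [\<alpha>\<^sub>\<kk>(v), \<cdot>]\<close>, where \<open>\<alpha>\<close> is the Maurer-Cartan form of \<open>F\<close>; the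
  condition does not depend on the choice of \<open>F\<close>.
\<close>

definition tension ::
  "(complex \<Rightarrow> real ^ (4 + 'n::finite) ^ (4 + 'n)) \<Rightarrow> complex \<Rightarrow> real ^ (4 + 'n) ^ (4 + 'n)" where
  "tension F z = (\<Sum>v\<in>{1, \<i>}.
     frechet_derivative (\<lambda>p. p_part (maurer_cartan F p v)) (at z) v
     + (k_part (maurer_cartan F z v) ** p_part (maurer_cartan F z v)
        - p_part (maurer_cartan F z v) ** k_part (maurer_cartan F z v)))"

definition harmonic_map :: "complex set \<Rightarrow> (complex \<Rightarrow> ('n::finite) basis4 set) \<Rightarrow> bool" where
  "harmonic_map D f \<longleftrightarrow>
     (\<exists>F. smooth_map_on D F \<and>
       (\<forall>z\<in>D. F z \<in> SO_plus (Inl 1) \<and> f z = mod_K (F z) \<and> tension F z = 0))"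

definition willmore_surface ::
  "complex set \<Rightarrow> (complex \<Rightarrow> real ^ (3 + 'n::finite)) \<Rightarrow> bool" where
  "willmore_surface D y \<longleftrightarrow>
     conformal_immersion D y \<and> (\<exists>f. conformal_gauss_map D y f \<and> harmonic_map D f)"

definition reversing_symmetry ::
  "complex set \<Rightarrow> (complex \<Rightarrow> real ^ (3 + 'n::finite)) \<Rightarrow>
   (complex \<Rightarrow> complex) \<Rightarrow> (real ^ (3 + 'n) \<Rightarrow> real ^ (3 + 'n)) \<Rightarrow> bool" where
  "reversing_symmetry D y \<mu> S \<longleftrightarrow>
     bij_betw \<mu> D D \<and> (\<lambda>z. cnj (\<mu> z)) holomorphic_on D \<and>
     conformal_diffeo S \<and> S ` (y ` D) = y ` D \<and> (\<forall>z\<in>D. y (\<mu> z) = S (y z))"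


section \<open>The extended frame\<close>

text \<open>The \<open>(1,0)\<close>- and \<open>(0,1)\<close>-parts of a real-linear form \<open>\<omega>\<close> on \<open>\<complex>\<close>.\<close>

definition part10 :: "(complex \<Rightarrow> complex ^ 'm ^ 'k) \<Rightarrow> complex \<Rightarrow> complex ^ 'm ^ 'k" where
  "part10 \<omega> v = cscale (1/2) (\<omega> v - cscale \<i> (\<omega> (\<i> * v)))"

definition part01 :: "(complex \<Rightarrow> complex ^ 'm ^ 'k) \<Rightarrow> complex \<Rightarrow> complex ^ 'm ^ 'k" where
  "part01 \<omega> v = cscale (1/2) (\<omega> v + cscale \<i> (\<omega> (\<i> * v)))"

definition alpha_lambda ::
  "(complex \<Rightarrow> real ^ (4 + 'n::finite) ^ (4 + 'n)) \<Rightarrow> complex \<Rightarrow> complex \<Rightarrow> complex \<Rightarrow>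
   complex ^ (4 + 'n) ^ (4 + 'n)" where
  "alpha_lambda F lam z v =
     cscale (inverse lam) (part10 (\<lambda>w. cmat (p_part (maurer_cartan F z w))) v)
     + cmat (k_part (maurer_cartan F z v))
     + cscale lam (part01 (\<lambda>w. cmat (p_part (maurer_cartan F z w))) v)"

text \<open>
  For \<open>\<bar>\<lambda>\<bar> = 1\<close> the form \<open>\<alpha>\<^sub>\<lambda>\<close> is real, so its solution with initial value \<open>I\<close> is real.
\<close>

definition extended_frame ::
  "complex set \<Rightarrow> complex \<Rightarrow> (complex \<Rightarrow> real ^ (4 + 'n::finite) ^ (4 + 'n)) \<Rightarrow>
   (complex \<Rightarrow> complex \<Rightarrow> real ^ (4 + 'n) ^ (4 + 'n)) \<Rightarrow> bool" where
  "extended_frame D z0 F Fx \<longleftrightarrow>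
     (\<forall>z\<in>D. Fx z 1 = F z) \<and>
     (\<forall>lam\<in>sphere 0 1. Fx z0 lam = mat 1 \<and>
        (\<forall>z\<in>D. (\<lambda>p. Fx p lam) differentiable (at z) \<and>
           (\<forall>v. cmat (frechet_derivative (\<lambda>p. Fx p lam) (at z) v) =
                cmat (Fx z lam) ** alpha_lambda F lam z v)))"

definition k1_matrix :: "real \<Rightarrow> real \<Rightarrow> real \<Rightarrow> real \<Rightarrow> real ^ 4 ^ 4" where
  "k1_matrix \<tau> \<theta> a b = vector [
     vector [(exp \<tau> + exp (- \<tau>) * (a\<^sup>2 + b\<^sup>2 + 1)) / 2,
             (- exp \<tau> + exp (- \<tau>) * (a\<^sup>2 + b\<^sup>2 + 1)) / 2,
             - a * cos \<theta> - b * sin \<theta>,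
             - a * sin \<theta> + b * cos \<theta>],
     vector [(- exp \<tau> - exp (- \<tau>) * (a\<^sup>2 + b\<^sup>2 - 1)) / 2,
             (exp \<tau> - exp (- \<tau>) * (a\<^sup>2 + b\<^sup>2 - 1)) / 2,
             a * cos \<theta> + b * sin \<theta>,
             a * sin \<theta> - b * cos \<theta>],
     vector [- a * exp (- \<tau>), - a * exp (- \<tau>), cos \<theta>, sin \<theta>],
     vector [- b * exp (- \<tau>), - b * exp (- \<tau>), sin \<theta>, - cos \<theta>]]"

end

theory Submission
  imports Defs "HOL-Complex_Analysis.Conformal_Mappings"
begin

text \<open>
  Write \<open>Y\<close> for the canonical lift. The symmetry gives \<open>Y \<circ> \<mu> = c S Y\<close>, and the normalisation of \<open>Y\<close>
  forces \<open>c\<close> to be the conformal factor of \<open>\<mu>\<close>. Differentiating twice, \<open>S\<close> maps the Gauss space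
  at \<open>z\<close> onto the one at \<open>\<mu> z\<close>, so \<open>F \<circ> \<mu> = S F k\<close> with \<open>k\<close> block diagonal; its first block is determined by the images of
  \<open>Y\<close>, \<open>e\<^sub>1\<close> and \<open>e\<^sub>2\<close> because it preserves the Lorentz product. As \<open>\<mu>\<close> is antiholomorphic,
  \<open>F(\<mu> z, \<lambda>)\<close> and \<open>F(z, \<lambda>\<^sup>-\<^sup>1) k(z)\<close> solve the same linear equation \<open>dG = G \<beta>\<close>, so they differ by a
  left factor \<open>M(\<lambda>)\<close> that does not depend on \<open>z\<close>.
\<close>

section \<open>Lorentz matrices\<close>

text \<open>On the unit circle the p-part of \<open>alpha_lambda\<close> at a tangent vector
  \<open>v\<close> is the p-part of \<open>\<alpha>\<close> at \<open>cnj lam * v\<close>. A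
  conjugate linear differential turns the factor \<open>cnj lam\<close> into \<open>lam\<close>;
  this is the whole reason for \<open>inverse lam\<close> on the right. Two solutions
  \<open>G\<close> and \<open>H\<close> are compared through
  \<open>G ** minkowski t ** transpose H\<close>, whose derivative vanishes when the coefficients
  lie in the Lorentz algebra, so uniqueness takes no theory of differential equations. The extended
  frame is given separately for each \<open>lam\<close>, hence continuity of \<open>M\<close> is not
  part of the data and needs an estimate of its own. The vector \<open>N\<close> is known only
  through membership in the Gauss space and product relations, so its image under the symmetry is
  never computed: orthogonality of the Laplacian to the transported normals gives the zero block,
  and the Lorentz relations give the rest. With \<open>L\<close> a logarithm of the derivative of
  \<open>cnj \<circ> \<mu>\<close>, the numbers \<open>a\<close> and \<open>b\<close> come from
  differentiating the factor \<open>exp (Re L)\<close> of the lift; their \<open>sqrt 2\<close>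
  comes from \<open>Y\<close> being the difference of the first two frame columns divided by
  \<open>sqrt 2\<close>.\<close>

lemma minkowski_mult_left:
  fixes A :: "'a::comm_ring_1 ^ 'k ^ 'm::finite"
  shows "(minkowski t ** A) $ i $ j = (if i = t then - A $ i $ j else A $ i $ j)"
  by (simp add: minkowski_def matrix_matrix_mult_def if_distrib[of "\<lambda>x. x * _"] cong: if_cong)

lemma minkowski_mult_right:
  fixes A :: "'a::comm_ring_1 ^ 'm::finite ^ 'k"
  shows "(A ** minkowski t) $ i $ j = (if j = t then - A $ i $ j else A $ i $ j)"
  by (simp add: minkowski_def matrix_matrix_mult_def if_distrib[of "\<lambda>x. _ * x"] cong: if_cong)

lemma minkowski_mult_vector:
  fixes x :: "'a::comm_ring_1 ^ 'm::finite"
  shows "(minkowski t *v x) $ i = (if i = t then - x $ i else x $ i)"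
  by (simp add: minkowski_def matrix_vector_mult_def if_distrib[of "\<lambda>x. x * _"] cong: if_cong)

lemma minkowski_square [simp]: "minkowski t ** minkowski t
    = (mat 1 :: 'a::comm_ring_1 ^ 'm ^ 'm::finite)"
  by (vector minkowski_mult_left) (simp add: minkowski_def mat_def)

lemma minkowski_cancel [simp]:
  fixes A :: "'a::comm_ring_1 ^ 'k ^ 'm::finite"
  shows "minkowski t ** (minkowski t ** A) = A"
  by (simp add: matrix_mul_assoc)

lemma transpose_minkowski [simp]: "transpose (minkowski t) = minkowski t"
  by (auto simp: minkowski_def transpose_def vec_eq_iff)

text \<open>The algebraic half of \<open>O_plus\<close>. This half is propagated by the differential
  equation; preservation of the forward cone is recovered afterwards by connectedness.\<close>

definition lorentz_matrix :: "'m::finite \<Rightarrow> real ^ 'm ^ 'm \<Rightarrow> bool" where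
  "lorentz_matrix t A \<longleftrightarrow> transpose A ** minkowski t ** A = minkowski t"

text \<open>The inverse of a Lorentz matrix, in a form that is linear in \<open>A\<close>: it can be
  differentiated and commutes with \<open>sigma\<close> without any argument about
  invertibility.\<close>

definition lorentz_inv :: "'m::finite \<Rightarrow> real ^ 'm ^ 'm \<Rightarrow> real ^ 'm ^ 'm" where
  "lorentz_inv t A = minkowski t ** transpose A ** minkowski t"

lemma lorentz_inv_left: "lorentz_matrix t A \<Longrightarrow> lorentz_inv t A ** A = mat 1"
  unfolding lorentz_matrix_def lorentz_inv_def by (simp flip: matrix_mul_assoc)

lemma lorentz_inv_right: "lorentz_matrix t A \<Longrightarrow> A ** lorentz_inv t A = mat 1"
  using lorentz_inv_left matrix_left_right_inverse by blast

lemma lorentz_matrix_cancel: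
  assumes "lorentz_matrix t A"
  shows "lorentz_inv t A ** (A ** B) = B" "A ** (lorentz_inv t A ** B) = B"
    "lorentz_inv t A *v (A *v x) = x" "A *v (lorentz_inv t A *v x) = x"
  using lorentz_inv_left[OF assms] lorentz_inv_right[OF assms]
  by (simp_all add: matrix_mul_assoc matrix_vector_mul_assoc)

lemma lorentz_matrix_cancel_right:
  assumes "lorentz_matrix t A"
  shows "B ** A ** lorentz_inv t A = B" "B ** lorentz_inv t A ** A = B"
  using lorentz_inv_left[OF assms] lorentz_inv_right[OF assms]
  by (simp_all flip: matrix_mul_assoc)

lemma matrix_inv_unique:
  fixes A :: "real ^ 'm ^ 'm::finite"
  assumes "A ** B = mat 1"
  shows "matrix_inv A = B"
proof -
  have BA: "B ** A = mat 1" using assms matrix_left_right_inverse by blast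
  have "invertible A" unfolding invertible_def using assms BA by blast
  then have "A ** matrix_inv A = mat 1 \<and> matrix_inv A ** A = mat 1"
    unfolding invertible_def matrix_inv_def by (rule someI_ex)
  then have "matrix_inv A ** A ** B = B" by simp
  then show ?thesis by (simp flip: matrix_mul_assoc add: assms)
qed

lemma matrix_inv_lorentz: "lorentz_matrix t A \<Longrightarrow> matrix_inv A = lorentz_inv t A"
  by (intro matrix_inv_unique lorentz_inv_right)

lemma lorentz_matrix_mult:
  "lorentz_matrix t A \<Longrightarrow> lorentz_matrix t B \<Longrightarrow> lorentz_matrix t (A ** B)"
proof -
  assume A: "lorentz_matrix t A" and B: "lorentz_matrix t B"
  have "transpose (A ** B) ** minkowski t ** (A ** B)
      = transpose B ** (transpose A ** minkowski t ** A) ** B"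
    by (simp add: matrix_transpose_mul matrix_mul_assoc)
  then show ?thesis using A B by (simp add: lorentz_matrix_def)
qed

lemma lorentz_matrix_transpose:
  assumes "lorentz_matrix t A"
  shows "A ** minkowski t ** transpose A = minkowski t"
proof -
  have "A ** minkowski t ** transpose A ** minkowski t = mat 1"
    using lorentz_inv_right[OF assms] by (simp add: lorentz_inv_def matrix_mul_assoc)
  then have "A ** minkowski t ** transpose A ** minkowski t ** minkowski t = minkowski t"
    by simp
  then show ?thesis by (simp flip: matrix_mul_assoc)
qed

lemma lorentz_matrix_if_transpose:
  assumes "A ** minkowski t ** transpose A = minkowski t"
  shows "lorentz_matrix t A"
proof -
  have "lorentz_matrix t (transpose A)"
    using assms by (simp add: lorentz_matrix_def)
  from lorentz_matrix_transpose[OF this] show ?thesis by (simp add: lorentz_matrix_def)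
qed

lemma lorentz_matrix_inv:
  assumes "lorentz_matrix t A"
  shows "lorentz_matrix t (lorentz_inv t A)"
proof -
  have "transpose (lorentz_inv t A) ** minkowski t ** lorentz_inv t A
      = minkowski t ** (A ** minkowski t ** transpose A) ** minkowski t"
    by (simp add: lorentz_inv_def matrix_transpose_mul flip: matrix_mul_assoc)
  then show ?thesis by (simp add: lorentz_matrix_def lorentz_matrix_transpose[OF assms])
qed

lemma lor_eq_inner: "lor t x y = x \<bullet> (minkowski t *v y)" for x :: "real ^ 'm::finite"
  by (simp add: lor_def inner_vec_def)

lemma lor_eq_sum: "lor t x y = (\<Sum>i\<in>UNIV. (if i = t then - 1 else 1) * (x $ i * y $ i))"
  for x :: "'a::comm_ring_1 ^ 'm::finite"
  unfolding lor_def by (rule sum.cong) (auto simp: minkowski_mult_vector)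

lemma bounded_bilinear_lor: "bounded_bilinear (lor t :: real ^ 'm \<Rightarrow> real ^ 'm::finite \<Rightarrow> real)"
proof -
  have "bilinear (lor t :: real ^ 'm \<Rightarrow> real ^ 'm \<Rightarrow> real)"
    unfolding bilinear_def lor_eq_inner
    by (auto intro!: linearI simp: matrix_vector_right_distrib inner_add_left inner_add_right
          matrix_vector_mult_scaleR)
  then show ?thesis by (simp add: bilinear_conv_bounded_bilinear)
qed

lemmas lor_add_left = bounded_bilinear.add_left[OF bounded_bilinear_lor]
  and lor_add_right = bounded_bilinear.add_right[OF bounded_bilinear_lor]
  and lor_diff_left = bounded_bilinear.diff_left[OF bounded_bilinear_lor]
  and lor_diff_right = bounded_bilinear.diff_right[OF bounded_bilinear_lor]
  and lor_scaleR_left = bounded_bilinear.scaleR_left[OF bounded_bilinear_lor]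
  and lor_scaleR_right = bounded_bilinear.scaleR_right[OF bounded_bilinear_lor]
  and lor_minus_left = bounded_bilinear.minus_left[OF bounded_bilinear_lor]
  and lor_zero_left = bounded_bilinear.zero_left[OF bounded_bilinear_lor]

lemmas lor_linear = lor_add_left lor_add_right lor_diff_left lor_diff_right lor_scaleR_left
  lor_scaleR_right lor_minus_left lor_zero_left

lemma lor_commute: "lor t x y = lor t y x" for x :: "'a::comm_ring_1 ^ 'm::finite"
  by (simp add: lor_eq_sum mult.commute)

lemma lor_matrix_mult:
  assumes "lorentz_matrix t A"
  shows "lor t (A *v x) (A *v y) = lor t x y"
proof -
  have "lor t (A *v x) (A *v y) = x \<bullet> (transpose A ** minkowski t ** A *v y)"
    unfolding lor_eq_inner matrix_mul_assoc[symmetric] matrix_vector_mul_assoc[symmetric]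
    by (simp flip: dot_lmul_matrix del: transpose_matrix_vector)
  then show ?thesis using assms by (simp add: lorentz_matrix_def lor_eq_inner)
qed

lemma lor_column: "lor t (column i A) (column j A) = (transpose A ** minkowski t ** A) $ i $ j"
  for A :: "real ^ 'k ^ 'm::finite"
  by (simp add: lor_eq_sum matrix_matrix_mult_def[of _ A] minkowski_mult_right transpose_def
      column_def)
     (auto intro!: sum.cong)

lemma lor_column_lorentz:
  "lorentz_matrix t A \<Longrightarrow> lor t (column i A) (column j A) = minkowski t $ i $ j"
  by (simp add: lor_column lorentz_matrix_def)

lemma lorentz_inv_nth:
  "(lorentz_inv t A ** B) $ i $ j = (if i = t then - 1 else 1) * lor t (column i A) (column j B)"
  for A :: "real ^ 'm ^ 'm::finite"
  by (simp add: lorentz_inv_def lor_eq_sum matrix_matrix_mult_def[of _ B] minkowski_mult_left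
        minkowski_mult_right transpose_def column_def sum_negf[symmetric])
     (auto intro!: sum.cong simp: minkowski_mult_left)

text \<open>With vanishing time component the Lorentz product of \<open>x\<close> with itself is the
  Euclidean one, which is definite.\<close>

lemma null_time_nonzero:
  fixes x :: "real ^ 'm::finite"
  assumes "lor t x x = 0" "x \<noteq> 0"
  shows "x $ t \<noteq> 0"
proof
  assume "x $ t = 0"
  then have "lor t x x = x \<bullet> x"
    unfolding lor_eq_sum inner_vec_def by (intro sum.cong) auto
  with assms show False by simp
qed

lemma O_plusI:
  "lorentz_matrix t A \<Longrightarrow> (\<And>x. x \<in> forward_cone t \<Longrightarrow> (A *v x) $ t > 0) \<Longrightarrow> A \<in> O_plus t"
  by (auto simp: O_plus_def lorentz_matrix_def[symmetric] forward_cone_def lor_matrix_mult)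

lemma O_plus_lorentz: "A \<in> O_plus t \<Longrightarrow> lorentz_matrix t A"
  by (simp add: O_plus_def lorentz_matrix_def)

lemma O_plus_cone: "A \<in> O_plus t \<Longrightarrow> x \<in> forward_cone t \<Longrightarrow> A *v x \<in> forward_cone t"
  by (simp add: O_plus_def)

lemma forward_coneD: "x \<in> forward_cone t \<Longrightarrow> x $ t > 0" "x \<in> forward_cone t \<Longrightarrow> lor t x x = 0"
  by (simp_all add: forward_cone_def)

lemma O_plus_mult:
  assumes "A \<in> O_plus t" "B \<in> O_plus t"
  shows "A ** B \<in> O_plus t"
proof (rule O_plusI)
  show "lorentz_matrix t (A ** B)" using assms by (simp add: lorentz_matrix_mult O_plus_lorentz)
  fix x assume "x \<in> forward_cone t"
  then have "A *v (B *v x) \<in> forward_cone t" using assms O_plus_cone by blast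
  then show "(A ** B *v x) $ t > 0" by (simp add: matrix_vector_mul_assoc forward_coneD)
qed

lemma lorentz_time_nonzero:
  assumes "lorentz_matrix t A" "x \<in> forward_cone t"
  shows "(A *v x) $ t \<noteq> 0"
proof (rule null_time_nonzero)
  show "lor t (A *v x) (A *v x) = 0"
    using assms by (simp add: lor_matrix_mult forward_coneD)
  show "A *v x \<noteq> 0"
  proof
    assume "A *v x = 0"
    then have "x = 0" using lorentz_matrix_cancel(3)[OF assms(1), of x] by simp
    then show False using forward_coneD(1)[OF assms(2)] by simp
  qed
qed

text \<open>If the preimage \<open>w\<close> of a forward null vector \<open>x\<close> pointed
  backward, then \<open>- w\<close> would be forward, and \<open>A\<close> would send it to the
  backward vector \<open>- x\<close>.\<close>

lemma O_plus_inv: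
  assumes A: "A \<in> O_plus t"
  shows "lorentz_inv t A \<in> O_plus t"
proof (rule O_plusI)
  have L: "lorentz_matrix t A" using A by (rule O_plus_lorentz)
  show LI: "lorentz_matrix t (lorentz_inv t A)" using L by (rule lorentz_matrix_inv)
  fix x assume x: "x \<in> forward_cone t"
  let ?w = "lorentz_inv t A *v x"
  show "?w $ t > 0"
  proof (rule ccontr)
    assume "\<not> ?w $ t > 0"
    with lorentz_time_nonzero[OF LI x] have "(- ?w) $ t > 0" by simp
    moreover have "lor t (- ?w) (- ?w) = 0"
      using lor_matrix_mult[OF LI, of x x] forward_coneD[OF x]
      by (simp add: bounded_bilinear.minus_left[OF bounded_bilinear_lor]
            bounded_bilinear.minus_right[OF bounded_bilinear_lor])
    ultimately have "- ?w \<in> forward_cone t" by (simp add: forward_cone_def)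
    then have "A *v (- ?w) \<in> forward_cone t" using A O_plus_cone by blast
    moreover have "A *v (- ?w) = - x"
      using lorentz_matrix_cancel(4)[OF L, of x]
      by (simp add: linear_neg[OF matrix_vector_mul_linear])
    ultimately show False using forward_coneD[OF x] by (auto simp: forward_cone_def)
  qed
qed

lemma det_minkowski: "det (minkowski t :: real ^ 'm ^ 'm::finite) \<noteq> 0"
  using minkowski_square[of t] by (metis det_I det_mul mult_zero_left zero_neq_one)

lemma det_lorentz_square: "lorentz_matrix t A \<Longrightarrow> det A * det A = 1"
  unfolding lorentz_matrix_def
  by (drule arg_cong[where f = det]) (use det_minkowski[of t] in \<open>simp add: det_mul\<close>)

section \<open>Block matrices\<close>

lemma sum_UNIV_plus: "(\<Sum>i\<in>UNIV. g i) = (\<Sum>p\<in>UNIV. g (Inl p)) + (\<Sum>q\<in>UNIV. g (Inr q))"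
  for g :: "'a::finite + 'b::finite \<Rightarrow> 'c::comm_monoid_add"
  by (simp flip: UNIV_Plus_UNIV add: sum.Plus)

lemma blockdiag_nth [simp]:
  "blockdiag A B $ Inl p $ Inl q = A $ p $ q" "blockdiag A B $ Inl p $ Inr s = 0"
  "blockdiag A B $ Inr r $ Inl q = 0" "blockdiag A B $ Inr r $ Inr s = B $ r $ s"
  by (simp_all add: blockdiag_def)

lemma matrix_eq_plusI:
  fixes X Z :: "'a ^ ('p::finite + 'q::finite) ^ ('r::finite + 's::finite)"
  assumes "\<And>i j. X $ Inl i $ Inl j = Z $ Inl i $ Inl j" "\<And>i j. X $ Inl i $ Inr j
      = Z $ Inl i $ Inr j"
    "\<And>i j. X $ Inr i $ Inl j = Z $ Inr i $ Inl j" "\<And>i j. X $ Inr i $ Inr j = Z $ Inr i $ Inr j"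
  shows "X = Z"
proof -
  have "X $ i $ j = Z $ i $ j" for i j by (cases i; cases j) (simp_all add: assms)
  then show ?thesis by (simp add: vec_eq_iff)
qed

lemma blockdiag_mult:
  "blockdiag A B ** blockdiag C D = (blockdiag (A ** C) (B ** D) :: 'a::semiring_1 ^
      (4 + 'n::finite) ^ (4 + 'n))"
  by (rule matrix_eq_plusI) (simp_all add: matrix_matrix_mult_def sum_UNIV_plus)

lemma blockdiag_one: "blockdiag (mat 1) (mat 1)
    = (mat 1 :: 'a::zero_neq_one ^ (4 + 'n::finite) ^ (4 + 'n))"
  by (rule matrix_eq_plusI) (simp_all add: mat_def)

text \<open>Both sides are multiplicative, so elementary matrices suffice.\<close>

lemma det_blockdiag_left: "det (blockdiag A (mat 1) :: real ^ (4 + 'n::finite) ^ (4 + 'n)) = det A"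
proof (induction A rule: induct_matrix_elementary)
  case (1 A B)
  then show ?case by (simp add: det_mul flip:
      blockdiag_mult[of A "mat 1" B "mat 1" for A B, simplified])
next
  case (2 A i)
  have "row (Inl i) (blockdiag A (mat 1) :: real ^ (4 + 'n) ^ (4 + 'n)) = 0"
    using 2 by (auto simp: row_def vec_eq_iff blockdiag_def split: sum.split)
  then show ?case using 2 by (simp add: det_zero_row)
next
  case (3 A)
  have "det (blockdiag A (mat 1) :: real ^ (4 + 'n) ^ (4 + 'n))
      = (\<Prod>i\<in>UNIV. (blockdiag A (mat 1) :: real ^ (4 + 'n) ^ (4 + 'n)) $ i $ i)"
    by (rule det_diagonal) (use 3 in \<open>auto simp: blockdiag_def mat_def split: sum.split\<close>)
  also have "\<dots> = (\<Prod>i\<in>UNIV. A $ i $ i)"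
    by (simp flip: UNIV_Plus_UNIV add: prod.Plus mat_def)
  finally show ?case using 3 by (simp add: det_diagonal)
next
  case (4 m n)
  have "(blockdiag (\<chi> i j. mat 1 $ i $ Transposition.transpose m n j) (mat 1) :: real ^ (4 + 'n) ^
      (4 + 'n))
    = (\<chi> i j. mat 1 $ i $ Transposition.transpose (Inl m) (Inl n) j)"
    by (rule matrix_eq_plusI) (auto simp: mat_def Transposition.transpose_def)
  then show ?case using 4
    by (simp add: det_permute_columns permutes_swap_id sign_swap_id)
next
  case (5 m n c)
  have "(blockdiag (\<chi> i j. if i = m \<and> j = n then c else of_bool (i = j)) (mat 1) :: real ^
      (4 + 'n) ^ (4 + 'n))
    = (\<chi> i. if i = Inl m then row (Inl m) (mat 1) + c *s row (Inl n) (mat 1) else row i (mat 1))"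
    using 5 by (intro matrix_eq_plusI) (auto simp: mat_def row_def)
  moreover have "(\<chi> i j. if i = m \<and> j = n then c else of_bool (i = j))
    = ((\<chi> i. if i = m then row m (mat 1) + c *s row n (mat 1) else row i (mat 1)) :: real ^ 4 ^ 4)"
    using 5 by (auto simp: vec_eq_iff mat_def row_def)
  ultimately show ?case using 5 by (simp add: det_row_operation)
qed

lemma det_blockdiag_right: "det (blockdiag (mat 1) B :: real ^ (4 + 'n::finite) ^ (4 + 'n)) = det B"
proof (induction B rule: induct_matrix_elementary)
  case (1 A B)
  then show ?case by (simp add: det_mul flip:
      blockdiag_mult[of "mat 1" A "mat 1" B for A B, simplified])
next
  case (2 A i)
  have "row (Inr i) (blockdiag (mat 1) A :: real ^ (4 + 'n) ^ (4 + 'n)) = 0"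
    using 2 by (auto simp: row_def vec_eq_iff blockdiag_def split: sum.split)
  then show ?case using 2 by (simp add: det_zero_row)
next
  case (3 A)
  have "det (blockdiag (mat 1) A :: real ^ (4 + 'n) ^ (4 + 'n))
      = (\<Prod>i\<in>UNIV. (blockdiag (mat 1) A :: real ^ (4 + 'n) ^ (4 + 'n)) $ i $ i)"
    by (rule det_diagonal) (use 3 in \<open>auto simp: blockdiag_def mat_def split: sum.split\<close>)
  also have "\<dots> = (\<Prod>i\<in>UNIV. A $ i $ i)"
    by (simp flip: UNIV_Plus_UNIV add: prod.Plus mat_def)
  finally show ?case using 3 by (simp add: det_diagonal)
next
  case (4 m n)
  have "(blockdiag (mat 1) (\<chi> i j. mat 1 $ i $ Transposition.transpose m n j) :: real ^ (4 + 'n) ^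
      (4 + 'n))
    = (\<chi> i j. mat 1 $ i $ Transposition.transpose (Inr m) (Inr n) j)"
    by (rule matrix_eq_plusI) (auto simp: mat_def Transposition.transpose_def)
  then show ?case using 4
    by (simp add: det_permute_columns permutes_swap_id sign_swap_id)
next
  case (5 m n c)
  have "(blockdiag (mat 1) (\<chi> i j. if i = m \<and> j = n then c else of_bool (i = j)) :: real ^
      (4 + 'n) ^ (4 + 'n))
    = (\<chi> i. if i = Inr m then row (Inr m) (mat 1) + c *s row (Inr n) (mat 1) else row i (mat 1))"
    using 5 by (intro matrix_eq_plusI) (auto simp: mat_def row_def)
  moreover have "(\<chi> i j. if i = m \<and> j = n then c else of_bool (i = j))
    = ((\<chi> i. if i = m then row m (mat 1) + c *s row n (mat 1) else row i (mat 1)) :: real ^ 'n ^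
        'n)"
    using 5 by (auto simp: vec_eq_iff mat_def row_def)
  ultimately show ?case using 5 by (simp add: det_row_operation)
qed

lemma det_blockdiag: "det (blockdiag A B :: real ^ (4 + 'n::finite) ^ (4 + 'n)) = det A * det B"
proof -
  have "blockdiag A B = blockdiag A (mat 1) ** (blockdiag (mat 1) B :: real ^ (4 + 'n) ^ (4 + 'n))"
    by (simp add: blockdiag_mult)
  then show ?thesis by (simp add: det_mul det_blockdiag_left det_blockdiag_right)
qed

section \<open>The explicit matrix \<open>k1_matrix\<close>: determinant and
  characterization\<close>

lemma det_4:
  "det (A :: 'a::comm_ring_1 ^ 4 ^ 4) =
     A$1$1 * (A$2$2 * (A$3$3 * A$4$4 - A$3$4 * A$4$3) - A$2$3 * (A$3$2 * A$4$4 - A$3$4 * A$4$2)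
              + A$2$4 * (A$3$2 * A$4$3 - A$3$3 * A$4$2))
   - A$1$2 * (A$2$1 * (A$3$3 * A$4$4 - A$3$4 * A$4$3) - A$2$3 * (A$3$1 * A$4$4 - A$3$4 * A$4$1)
              + A$2$4 * (A$3$1 * A$4$3 - A$3$3 * A$4$1))
   + A$1$3 * (A$2$1 * (A$3$2 * A$4$4 - A$3$4 * A$4$2) - A$2$2 * (A$3$1 * A$4$4 - A$3$4 * A$4$1)
              + A$2$4 * (A$3$1 * A$4$2 - A$3$2 * A$4$1))
   - A$1$4 * (A$2$1 * (A$3$2 * A$4$3 - A$3$3 * A$4$2) - A$2$2 * (A$3$1 * A$4$3 - A$3$3 * A$4$1)
              + A$2$3 * (A$3$1 * A$4$2 - A$3$2 * A$4$1))"
proof -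
  have f1234: "finite {2::4, 3, 4}" "1 \<notin> {2::4, 3, 4}" and f234: "finite {3::4, 4}" "2 \<notin> {3::4, 4}"
    and f34: "finite {4::4}" "3 \<notin> {4::4}" by auto
  show ?thesis
    unfolding det_def UNIV_4
    unfolding sum_over_permutations_insert[OF f1234]
    unfolding sum_over_permutations_insert[OF f234]
    unfolding sum_over_permutations_insert[OF f34]
    unfolding permutes_sing
    by (simp add: sign_swap_id permutation_swap_id sign_compose sign_id permutation_compose)
       (simp add: algebra_simps)
qed

lemma det_k1_matrix: "det (k1_matrix \<tau> \<theta> a b) = - 1"
proof -
  \<comment> \<open>\<open>E\<close> and \<open>e\<close> are treated as independent letters: the
    determinant is then a polynomial identity, in which \<open>a\<close> and \<open>b\<close> drop
    out.\<close>
  define E e C S where defs: "E = exp \<tau>" "e = exp (- \<tau>)" "C = cos \<theta>" "S = sin \<theta>"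
  have "E * e = 1" "C\<^sup>2 + S\<^sup>2 = 1" by (simp_all add: defs flip: exp_add)
  moreover have "det (k1_matrix \<tau> \<theta> a b) = - (E * e) * (C\<^sup>2 + S\<^sup>2)"
    unfolding det_4 k1_matrix_def defs[symmetric]
    by (simp add: vector_def) (simp add: field_simps power2_eq_square)
  ultimately show ?thesis by simp
qed

text \<open>Only the sum \<open>w\<close> of the first two columns is missing. It is null,
  orthogonal to columns 3 and 4, and has product \<open>- 2\<close> with the null vector
  \<open>column 1 K - column 2 K\<close>. These four equations have a single solution; nullity is
  the origin of the terms quadratic in \<open>a\<close> and \<open>b\<close>.\<close>

lemma lorentz_null_fixing_eq_k1_matrix:
  fixes K :: "real ^ 4 ^ 4"
  assumes L: "lorentz_matrix 1 K"
    and null: "column 1 K - column 2 K = exp \<tau> *\<^sub>R (axis 1 1 - axis 2 1)"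
    and c3: "column 3 K = (- a * cos \<theta> - b * sin \<theta>) *\<^sub>R (axis 1 1 - axis 2 1)
               + cos \<theta> *\<^sub>R axis 3 1 + sin \<theta> *\<^sub>R axis 4 1"
    and c4: "column 4 K = (- a * sin \<theta> + b * cos \<theta>) *\<^sub>R (axis 1 1 - axis 2 1)
               + sin \<theta> *\<^sub>R axis 3 1 - cos \<theta> *\<^sub>R axis 4 1"
  shows "K = k1_matrix \<tau> \<theta> a b"
proof -
  have lor4: "lor 1 x y = - (x $ 1 * y $ 1) + x $ 2 * y $ 2 + x $ 3 * y $ 3 + x $ 4 * y $ 4"
    for x y :: "real ^ 4" by (simp add: lor_eq_sum sum_4)
  define E e C S where defs: "E = exp \<tau>" "e = exp (- \<tau>)" "C = cos \<theta>" "S = sin \<theta>"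
  have Ee: "E * e = 1" and CS: "C\<^sup>2 + S\<^sup>2 = 1" by (simp_all add: defs flip: exp_add)
  define w where "w = column 1 K + column 2 K"
  have lo: "lor 1 (column i K) (column j K) = minkowski 1 $ i $ j" for i j
    by (rule lor_column_lorentz[OF L])
  have ww: "lor 1 w w = 0" and w12: "lor 1 w (column 1 K - column 2 K) = - 2"
    and w3: "lor 1 w (column 3 K) = 0" and w4: "lor 1 w (column 4 K) = 0"
    by (simp_all add: w_def lor_linear lo minkowski_def)
  obtain w1 w2 w3 w4 where ws: "w $ 1 = w1" "w $ 2 = w2" "w $ 3 = w3" "w $ 4 = w4" by blast
  have "E * (w1 + w2) = 2"
    using w12 unfolding null lor4 defs ws by (simp add: axis_def algebra_simps)
  then have "e * (E * (w1 + w2)) = e * 2" by simp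
  then have "(E * e) * (w1 + w2) = 2 * e" by (simp only: ac_simps)
  then have sum: "w1 + w2 = 2 * e" unfolding Ee by simp
  \<comment> \<open>The coefficients of \<open>w3\<close> and \<open>w4\<close> in the two
    orthogonality relations form a reflection matrix, which is its own inverse. Recombining the
    relations with the same coefficients therefore isolates \<open>w3\<close> and
    \<open>w4\<close>.\<close>
  have 3: "(a * C + b * S) * (w1 + w2) + C * w3 + S * w4 = 0"
    using w3 unfolding c3 lor4 defs ws by (simp add: axis_def algebra_simps)
  have 4: "(a * S - b * C) * (w1 + w2) + S * w3 - C * w4 = 0"
    using w4 unfolding c4 lor4 defs ws by (simp add: axis_def algebra_simps)
  have "(C\<^sup>2 + S\<^sup>2) * (w3 + a * (w1 + w2))
      = C * ((a * C + b * S) * (w1 + w2) + C * w3 + S * w4)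
          + S * ((a * S - b * C) * (w1 + w2) + S * w3 - C * w4)"
    by (simp add: algebra_simps power2_eq_square)
  then have w3': "w3 = - 2 * a * e" unfolding 3 4 unfolding CS sum by simp
  have "(C\<^sup>2 + S\<^sup>2) * (w4 + b * (w1 + w2))
      = S * ((a * C + b * S) * (w1 + w2) + C * w3 + S * w4) - C *
          ((a * S - b * C) * (w1 + w2) + S * w3 - C * w4)"
    by (simp add: algebra_simps power2_eq_square)
  then have w4': "w4 = - 2 * b * e" unfolding 3 4 unfolding CS sum by simp
  \<comment> \<open>Nullity in light-cone coordinates: as \<open>w1 + w2\<close> is known, the
    equation is linear in \<open>w1 - w2\<close>.\<close>
  have "(w1 - w2) * (w1 + w2) = w3\<^sup>2 + w4\<^sup>2"
    using ww unfolding lor4 ws by (simp add: algebra_simps power2_eq_square)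
  then have "(w1 - w2) * (2 * e) = 4 * (a\<^sup>2 + b\<^sup>2) * e * e"
    unfolding sum w3' w4' by (simp add: algebra_simps power2_eq_square)
  moreover have "e \<noteq> 0" using Ee by auto
  ultimately have "(w1 - w2) * 2 = 4 * (a\<^sup>2 + b\<^sup>2) * e" by simp
  then have diff: "w1 - w2 = 2 * (a\<^sup>2 + b\<^sup>2) * e" by (simp add: algebra_simps)
  have col1: "column 1 K = (1/2) *\<^sub>R (w + exp \<tau> *\<^sub>R (axis 1 1 - axis 2 1))"
    and col2: "column 2 K = (1/2) *\<^sub>R (w - exp \<tau> *\<^sub>R (axis 1 1 - axis 2 1))"
    unfolding null[symmetric] w_def by (simp_all add: vec_eq_iff)
  have w1': "w1 = e * (a\<^sup>2 + b\<^sup>2 + 1)" and w2': "w2 = - e * (a\<^sup>2 + b\<^sup>2 - 1)"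
    using sum diff by (simp_all add: algebra_simps)
  have K: "K $ i $ j = column j K $ i" for i j by (simp add: column_def)
  show ?thesis
    unfolding vec_eq_iff forall_4 K col1 col2 c3 c4 k1_matrix_def
    by (simp add: vector_def axis_def ws w1' w2' w3' w4' defs(2) diff_divide_distrib
        add_divide_distrib)
qed

lemma lorentz_product_nth:
  "(transpose A ** minkowski t ** B) $ i $ j
      = (\<Sum>k\<in>UNIV. (if k = t then - 1 else 1) * (A $ k $ i * B $ k $ j))"
  for A :: "'a::comm_ring_1 ^ 'p ^ 'm::finite" and B :: "'a ^ 'q ^ 'm"
  by (simp add: matrix_matrix_mult_def[of _ B] minkowski_mult_right transpose_def)
      (auto intro!: sum.cong)

lemma minkowski_nth: "minkowski t $ i $ j = (if i = j then (if i = t then - 1 else 1) else 0)"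
  by (simp add: minkowski_def)

definition upper_left :: "'a ^ (4 + 'n::finite) ^ (4 + 'n) \<Rightarrow> 'a ^ 4 ^ 4" where
  "upper_left X = (\<chi> i j. X $ Inl i $ Inl j)"

definition lower_right :: "'a ^ (4 + 'n::finite) ^ (4 + 'n) \<Rightarrow> 'a ^ 'n ^ 'n" where
  "lower_right X = (\<chi> i j. X $ Inr i $ Inr j)"

text \<open>The upper left block is itself Lorentzian, hence invertible, and the mixed part of the
  Lorentz relation then kills the upper right block. So it is enough to know that a change of frame
  maps one Gauss space into the other.\<close>

lemma lorentz_block_triangular:
  fixes X :: "real ^ (4 + 'n::finite) ^ (4 + 'n)"
  assumes L: "lorentz_matrix (Inl 1) X" and zero: "\<And>i j. X $ Inr i $ Inl j = 0"
  shows "X = blockdiag (upper_left X) (lower_right X)"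
    and "lorentz_matrix 1 (upper_left X)" and "orthogonal_matrix (lower_right X)"
proof -
  define B :: "real ^ 'n ^ 4" where "B = (\<chi> i j. X $ Inl i $ Inr j)"
  have eq: "(transpose X ** minkowski (Inl 1) ** X) $ i $ j = minkowski (Inl 1) $ i $ j" for i j
    using L by (simp add: lorentz_matrix_def)
  note expand = lorentz_product_nth minkowski_nth upper_left_def lower_right_def B_def
      sum_UNIV_plus zero
  show K1: "lorentz_matrix 1 (upper_left X)"
    unfolding lorentz_matrix_def vec_eq_iff
  proof (intro allI)
    fix i j :: 4
    show "(transpose (upper_left X) ** minkowski 1 ** upper_left X) $ i $ j = minkowski 1 $ i $ j"
      using eq[of "Inl i" "Inl j"] by (simp add: expand cong: if_cong)
  qed
  have "transpose (upper_left X) ** minkowski 1 ** B = 0"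
    unfolding vec_eq_iff
  proof (intro allI)
    fix i j
    show "(transpose (upper_left X) ** minkowski 1 ** B) $ i $ j = 0 $ i $ j"
      using eq[of "Inl i" "Inr j"] by (simp add: expand cong: if_cong)
  qed
  then have "upper_left X ** minkowski 1 ** (transpose (upper_left X) ** minkowski 1 ** B) = 0"
    by (simp add: matrix_matrix_mult_def vec_eq_iff)
  then have "(upper_left X ** minkowski 1 ** transpose (upper_left X)) ** minkowski 1 ** B = 0"
    by (simp add: matrix_mul_assoc)
  then have B0: "B = 0" by (simp add: lorentz_matrix_transpose[OF K1])
  then have zero': "X $ Inl i $ Inr j = 0" for i j by (simp add: B_def vec_eq_iff)
  show "X = blockdiag (upper_left X) (lower_right X)"
    by (rule matrix_eq_plusI) (simp_all add: zero zero' upper_left_def lower_right_def)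
  have "transpose (lower_right X) ** lower_right X = mat 1"
    unfolding vec_eq_iff
  proof (intro allI)
    fix i j
    have "(transpose (lower_right X) ** lower_right X) $ i $ j
        = (\<Sum>k\<in>UNIV. X $ Inr k $ Inr i * X $ Inr k $ Inr j)"
      by (simp add: matrix_matrix_mult_def transpose_def lower_right_def)
    then show "(transpose (lower_right X) ** lower_right X) $ i $ j = mat 1 $ i $ j"
      using eq[of "Inr i" "Inr j"] by (simp add: expand zero' mat_def cong: if_cong)
  qed
  then show "orthogonal_matrix (lower_right X)" by (simp add: orthogonal_matrix)
qed

text \<open>Padding with zeros embeds the four-dimensional forward cone into the large one.\<close>

lemma blockdiag_O_plus_imp:
  assumes "blockdiag A B \<in> O_plus (Inl 1 :: 4 + 'n::finite)" "lorentz_matrix 1 A"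
  shows "A \<in> O_plus 1"
proof (rule O_plusI[OF assms(2)])
  fix x :: "real ^ 4" assume x: "x \<in> forward_cone 1"
  define x' :: "real ^ (4 + 'n)" where "x' = (\<chi> i. case i of Inl p \<Rightarrow> x $ p | Inr q \<Rightarrow> 0)"
  have "lor (Inl 1) x' x' = lor 1 x x"
    by (simp add: lor_eq_sum sum_UNIV_plus x'_def cong: if_cong)
  then have "x' \<in> forward_cone (Inl 1)"
    using forward_coneD[OF x] by (simp add: forward_cone_def x'_def)
  then have "(blockdiag A B *v x') $ Inl 1 > 0" using assms(1) O_plus_cone forward_coneD(1) by blast
  moreover have "(blockdiag A B *v x') $ Inl 1 = (A *v x) $ 1"
    by (simp add: matrix_vector_mult_def sum_UNIV_plus x'_def)
  ultimately show "(A *v x) $ 1 > 0" by simp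
qed

section \<open>The involution \<open>sigma\<close> and its eigenspaces\<close>

abbreviation sigma_matrix :: "real ^ (4 + 'n::finite) ^ (4 + 'n)" where
  "sigma_matrix \<equiv> blockdiag (- mat 1) (mat 1)"

lemma sigma_matrix_square: "sigma_matrix ** sigma_matrix
    = (mat 1 :: real ^ (4 + 'n::finite) ^ (4 + 'n))"
proof -
  have "(- mat 1) ** (- mat 1) = (mat 1 :: real ^ 4 ^ 4)"
    by (simp add: matrix_matrix_mult_def mat_def vec_eq_iff forall_4 sum_4)
  then show ?thesis by (simp add: blockdiag_mult blockdiag_one)
qed

lemma sigma_eq: "sigma X = sigma_matrix ** X ** sigma_matrix"
  unfolding sigma_def by (simp add: matrix_inv_unique[OF sigma_matrix_square])

lemma sigma_nth:
  "sigma X $ Inl i $ Inl j = X $ Inl i $ Inl j" "sigma X $ Inl i $ Inr j' = - X $ Inl i $ Inr j'"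
  "sigma X $ Inr i' $ Inl j = - X $ Inr i' $ Inl j" "sigma X $ Inr i' $ Inr j'
      = X $ Inr i' $ Inr j'"
  by (simp_all add: sigma_eq matrix_matrix_mult_def sum_UNIV_plus mat_def
      if_distrib[of "\<lambda>x. x * _"] if_distrib[of "\<lambda>x. _ * x"] if_distrib[of uminus] cong: if_cong)

lemma sigma_mult: "sigma (X ** Z) = sigma X ** sigma Z"
proof -
  have "sigma X ** sigma Z = sigma_matrix ** X ** (sigma_matrix ** sigma_matrix) ** Z **
      sigma_matrix"
    by (simp add: sigma_eq matrix_mul_assoc)
  then show ?thesis by (simp add: sigma_matrix_square) (simp add: sigma_eq matrix_mul_assoc)
qed

lemma sigma_blockdiag: "sigma (blockdiag A B) = blockdiag A B"
  by (rule matrix_eq_plusI) (simp_all add: sigma_nth)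

lemma sigma_minkowski: "sigma (minkowski (Inl 1)) = minkowski (Inl 1)"
  by (rule matrix_eq_plusI) (simp_all add: sigma_nth minkowski_def)

lemma sigma_transpose: "sigma (transpose X) = transpose (sigma X)"
  by (rule matrix_eq_plusI) (simp_all add: sigma_nth transpose_def)

lemma linear_sigma: "linear sigma"
  by (rule linearI) (auto intro!: matrix_eq_plusI simp: sigma_nth)

lemma linear_p_part: "linear p_part" and linear_k_part: "linear k_part"
  unfolding p_part_def[abs_def] k_part_def[abs_def]
  by (auto intro!: linearI simp: linear_add[OF linear_sigma] linear_cmul[OF linear_sigma]
      algebra_simps)

lemma p_part_nth:
  "p_part X $ Inl i $ Inl j = 0" "p_part X $ Inl i $ Inr j' = X $ Inl i $ Inr j'"
  "p_part X $ Inr i' $ Inl j = X $ Inr i' $ Inl j" "p_part X $ Inr i' $ Inr j' = 0"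
  by (simp_all add: p_part_def sigma_nth)

lemma k_part_nth:
  "k_part X $ Inl i $ Inl j = X $ Inl i $ Inl j" "k_part X $ Inl i $ Inr j' = 0"
  "k_part X $ Inr i' $ Inl j = 0" "k_part X $ Inr i' $ Inr j' = X $ Inr i' $ Inr j'"
  by (simp_all add: k_part_def sigma_nth)

lemma sigma_p_part: "sigma (p_part X) = - p_part X" and sigma_k_part: "sigma (k_part X) = k_part X"
  by (auto intro!: matrix_eq_plusI simp: sigma_nth p_part_nth k_part_nth)

lemma bounded_bilinear_matrix_mult:
  "bounded_bilinear ((**) :: real ^ 'n ^ 'm \<Rightarrow> real ^ 'p ^ 'n \<Rightarrow> real ^ 'p ^ 'm)"
proof -
  have "bilinear ((**) :: real ^ 'n ^ 'm \<Rightarrow> real ^ 'p ^ 'n \<Rightarrow> real ^ 'p ^ 'm)"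
    unfolding bilinear_def
    by (auto intro!: linearI simp: vec_eq_iff
        matrix_matrix_mult_def sum_distrib_left sum.distrib[symmetric] algebra_simps)
  then show ?thesis by (simp add: bilinear_conv_bounded_bilinear)
qed

lemmas matrix_mult_linear =
  bounded_bilinear.add_left[OF bounded_bilinear_matrix_mult]
  bounded_bilinear.add_right[OF bounded_bilinear_matrix_mult]
  bounded_bilinear.diff_left[OF bounded_bilinear_matrix_mult]
  bounded_bilinear.diff_right[OF bounded_bilinear_matrix_mult]
  bounded_bilinear.minus_left[OF bounded_bilinear_matrix_mult]
  bounded_bilinear.minus_right[OF bounded_bilinear_matrix_mult]
  bounded_bilinear.scaleR_left[OF bounded_bilinear_matrix_mult]
  bounded_bilinear.scaleR_right[OF bounded_bilinear_matrix_mult]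
  bounded_bilinear.zero_left[OF bounded_bilinear_matrix_mult]
  bounded_bilinear.zero_right[OF bounded_bilinear_matrix_mult]

text \<open>Applied with one factor equal to the identity: multiplication by a block diagonal matrix
  from either side respects the splitting.\<close>

lemma p_part_conjugate:
  assumes "sigma A = A" "sigma B = B"
  shows "p_part (A ** X ** B) = A ** p_part X ** B"
  by (simp add: p_part_def sigma_mult assms matrix_mult_linear)

lemma k_part_conjugate:
  assumes "sigma A = A" "sigma B = B"
  shows "k_part (A ** X ** B) = A ** k_part X ** B"
  by (simp add: k_part_def sigma_mult assms matrix_mult_linear)

lemma sigma_lorentz_inv: "sigma (lorentz_inv (Inl 1) X) = lorentz_inv (Inl 1) (sigma X)"
  by (simp add: lorentz_inv_def sigma_mult sigma_minkowski sigma_transpose)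

lemma p_part_eq_0_iff: "p_part X = 0 \<longleftrightarrow> sigma X = X"
  by (auto simp: p_part_def)

lemma k_part_eq_iff: "k_part X = X \<longleftrightarrow> sigma X = X"
proof
  assume "k_part X = X" then show "sigma X = X" by (metis sigma_k_part)
next
  assume "sigma X = X" then show "k_part X = X" by (simp add: k_part_def flip: scaleR_2)
qed

section \<open>Linear differential equations for frames\<close>

lemmas matrix_mult_zero = bounded_bilinear.zero_left[OF bounded_bilinear_matrix_mult]
  bounded_bilinear.zero_right[OF bounded_bilinear_matrix_mult]
lemmas has_derivative_matrix_mult = bounded_bilinear.FDERIV[OF bounded_bilinear_matrix_mult]
lemmas continuous_on_matrix_mult = bounded_bilinear.continuous_on[OF bounded_bilinear_matrix_mult]

lemma linear_transpose: "linear (transpose :: real ^ 'n ^ 'm \<Rightarrow> real ^ 'm ^ 'n)"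
  by (rule linearI) (simp_all add: transpose_def vec_eq_iff)

lemma bounded_linear_transpose: "bounded_linear (transpose :: real ^ 'n ^ 'm \<Rightarrow> real ^ 'm ^ 'n)"
  using linear_transpose linear_conv_bounded_linear by blast

lemma linear_lorentz_inv: "linear (lorentz_inv t)"
  by (rule linearI)
     (simp_all add: lorentz_inv_def linear_add[OF linear_transpose]
         linear_cmul[OF linear_transpose] matrix_mult_linear)

lemma bounded_linear_lorentz_inv: "bounded_linear (lorentz_inv t)"
  using linear_lorentz_inv linear_conv_bounded_linear by blast

text \<open>Membership in the Lie algebra of the Lorentz group. The familiar condition has the
  transpose on the left; this equivalent form is the one that appears on differentiating
  \<open>G ** minkowski t ** transpose H\<close>.\<close>

definition lorentz_skew :: "'m::finite \<Rightarrow> real ^ 'm ^ 'm \<Rightarrow> bool" where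
  "lorentz_skew t A \<longleftrightarrow> A ** minkowski t + minkowski t ** transpose A = 0"

text \<open>The derivative of the product contains the skewness expression of \<open>A\<close>
  between \<open>G\<close> and \<open>transpose H\<close>, hence vanishes. Taking
  \<open>G = H\<close> shows that solutions stay Lorentzian; for two solutions, \<open>H\<close>
  being Lorentzian, it shows that they differ by a constant left factor.\<close>

lemma ode_product_constant:
  fixes G H :: "'a::real_normed_vector \<Rightarrow> real ^ 'm ^ 'm::finite"
  assumes "convex D"
    and G: "\<And>z. z \<in> D \<Longrightarrow> (G has_derivative (\<lambda>v. G z ** A z v)) (at z)"
    and H: "\<And>z. z \<in> D \<Longrightarrow> (H has_derivative (\<lambda>v. H z ** A z v)) (at z)"
    and skew: "\<And>z v. z \<in> D \<Longrightarrow> lorentz_skew t (A z v)"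
    and "z \<in> D" "w \<in> D"
  shows "G z ** minkowski t ** transpose (H z) = G w ** minkowski t ** transpose (H w)"
proof (rule has_derivative_zero_unique[OF \<open>convex D\<close> _ \<open>z \<in> D\<close> \<open>w \<in> D\<close>])
  fix x assume x: "x \<in> D"
  have GJ: "((\<lambda>z. G z ** minkowski t) has_derivative (\<lambda>v. G x ** A x v ** minkowski t))
      (at x within D)"
    using bounded_linear.has_derivative[OF
        bounded_bilinear.bounded_linear_left[OF bounded_bilinear_matrix_mult] G[OF x]]
    by (rule has_derivative_at_withinI)
  have HT: "((\<lambda>z. transpose (H z)) has_derivative (\<lambda>v. transpose (H x ** A x v))) (at x within D)"
    using bounded_linear.has_derivative[OF bounded_linear_transpose H[OF x]]
        by (rule has_derivative_at_withinI)
  have zero: "G x ** minkowski t ** transpose (H x ** A x v)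
      + G x ** A x v ** minkowski t ** transpose (H x) = 0" for v
  proof -
    have "G x ** minkowski t ** transpose (H x ** A x v)
        + G x ** A x v ** minkowski t ** transpose (H x)
        = G x ** (A x v ** minkowski t + minkowski t ** transpose (A x v)) ** transpose (H x)"
      by (simp add: matrix_transpose_mul matrix_mult_linear matrix_mul_assoc)
    then show ?thesis using skew[OF x, of v] by (simp add: lorentz_skew_def matrix_mult_zero)
  qed
  show "((\<lambda>z. G z ** minkowski t ** transpose (H z)) has_derivative (\<lambda>h. 0)) (at x within D)"
    using has_derivative_matrix_mult[OF GJ HT] unfolding zero .
qed

lemma lorentz_product_solve:
  assumes "G ** minkowski t ** transpose H = C" "lorentz_matrix t H"
  shows "G = C ** minkowski t ** H"
proof -
  have "C ** minkowski t ** H = G ** minkowski t ** (transpose H ** minkowski t ** H)"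
    unfolding assms(1)[symmetric] by (simp add: matrix_mul_assoc)
  then show ?thesis using assms(2) by (simp add: lorentz_matrix_def flip: matrix_mul_assoc)
qed

text \<open>Differentiating the constant \<open>F ** minkowski t ** transpose F\<close> gives the
  skewness expression multiplied by \<open>F\<close> on the left and by \<open>transpose F\<close>
  on the right; both factors are invertible.\<close>

lemma maurer_cartan_skew:
  fixes F :: "complex \<Rightarrow> real ^ 'm ^ 'm::finite"
  assumes "open D" "z \<in> D" and L: "\<And>p. p \<in> D \<Longrightarrow> lorentz_matrix t (F p)"
      and d: "F differentiable (at z)"
  shows "lorentz_skew t (maurer_cartan F z v)"
proof -
  let ?d = "frechet_derivative F (at z)" and ?A = "maurer_cartan F z v"
  have F: "(F has_derivative ?d) (at z)" using d frechet_derivative_works by blast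
  have "((\<lambda>p. F p ** minkowski t ** transpose (F p)) has_derivative
      (\<lambda>v. F z ** minkowski t ** transpose (?d v) + ?d v ** minkowski t ** transpose (F z))) (at z)"
    by (intro has_derivative_matrix_mult bounded_linear.has_derivative[OF bounded_linear_transpose]
        bounded_linear.has_derivative[OF
            bounded_bilinear.bounded_linear_left[OF bounded_bilinear_matrix_mult]] F)
  moreover have "((\<lambda>p. F p ** minkowski t ** transpose (F p)) has_derivative (\<lambda>v. 0)) (at z)"
    by (rule has_derivative_transform_within_open[OF has_derivative_const \<open>open D\<close> \<open>z \<in> D\<close>])
       (simp add: L lorentz_matrix_transpose)
  ultimately have "(\<lambda>v. F z ** minkowski t ** transpose (?d v)
      + ?d v ** minkowski t ** transpose (F z)) = (\<lambda>v. 0)"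
    by (rule has_derivative_unique)
  then have "F z ** minkowski t ** transpose (?d v) + ?d v ** minkowski t ** transpose (F z) = 0"
    by (rule fun_cong)
  moreover have "?d v = F z ** ?A"
    by (simp add: maurer_cartan_def matrix_inv_lorentz[OF L[OF \<open>z \<in> D\<close>]]
        lorentz_matrix_cancel[OF L[OF \<open>z \<in> D\<close>]])
  ultimately have "F z ** (?A ** minkowski t + minkowski t ** transpose ?A) ** transpose (F z) = 0"
    by (simp add: matrix_transpose_mul matrix_mult_linear matrix_mul_assoc add.commute)
  then have "lorentz_inv t (F z) ** (F z ** (?A ** minkowski t + minkowski t ** transpose ?A) **
      transpose (F z))
      ** (minkowski t ** F z ** minkowski t) = 0" by (simp add: matrix_mult_zero)
  moreover have "transpose (F z) ** (minkowski t ** F z ** minkowski t) = mat 1"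
    using L[OF \<open>z \<in> D\<close>] by (simp add: lorentz_matrix_def matrix_mul_assoc)
  ultimately show ?thesis unfolding lorentz_skew_def
    by (simp add: lorentz_matrix_cancel[OF L[OF \<open>z \<in> D\<close>]] flip: matrix_mul_assoc)
qed

lemma linear_skew_condition: "linear (\<lambda>A :: real ^ 'm ^ 'm. A ** minkowski t
    + minkowski t ** transpose A)"
  for t :: "'m::finite"
  by (rule linearI) (simp_all add: linear_add[OF linear_transpose] linear_cmul[OF linear_transpose]
      matrix_mult_linear scaleR_add_right)

lemma lorentz_skew_add: "lorentz_skew t A \<Longrightarrow> lorentz_skew t B \<Longrightarrow> lorentz_skew t (A + B)"
  using linear_add[OF linear_skew_condition[of t], of A B] by (simp only: lorentz_skew_def) simp

lemma lorentz_skew_diff: "lorentz_skew t A \<Longrightarrow> lorentz_skew t B \<Longrightarrow> lorentz_skew t (A - B)"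
  using linear_diff[OF linear_skew_condition[of t], of A B] by (simp only: lorentz_skew_def) simp

lemma lorentz_skew_scaleR: "lorentz_skew t A \<Longrightarrow> lorentz_skew t (c *\<^sub>R A)"
  using linear_cmul[OF linear_skew_condition[of t], of c A] by (simp only: lorentz_skew_def) simp

lemma lorentz_skew_sigma: "lorentz_skew (Inl 1) A \<Longrightarrow> lorentz_skew (Inl 1) (sigma A)"
proof -
  assume A: "lorentz_skew (Inl 1) A"
  have "sigma A ** minkowski (Inl 1) + minkowski (Inl 1) ** transpose (sigma A)
      = sigma (A ** minkowski (Inl 1) + minkowski (Inl 1) ** transpose A)"
    by (simp add: linear_add[OF linear_sigma] sigma_mult sigma_minkowski sigma_transpose)
  then show ?thesis using A by (simp add: lorentz_skew_def linear_0[OF linear_sigma])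
qed

lemma lorentz_skew_p_part: "lorentz_skew (Inl 1) A \<Longrightarrow> lorentz_skew (Inl 1) (p_part A)"
  and lorentz_skew_k_part: "lorentz_skew (Inl 1) A \<Longrightarrow> lorentz_skew (Inl 1) (k_part A)"
  by (simp_all add: p_part_def k_part_def lorentz_skew_scaleR lorentz_skew_add lorentz_skew_diff
      lorentz_skew_sigma)

text \<open>The real form of \<open>alpha_lambda\<close> for \<open>lam\<close> on the unit circle.
  There \<open>inverse lam = cnj lam\<close>, and combining the (1,0)- and (0,1)-parts amounts to
  evaluating the p-part at \<open>cnj lam * v\<close>.\<close>

definition real_alpha ::
  "(complex \<Rightarrow> real ^ (4 + 'n::finite) ^ (4 + 'n)) \<Rightarrow> complex \<Rightarrow> complex \<Rightarrow> complex \<Rightarrow> real ^ (4 + 'n)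
      ^ (4 + 'n)" where
  "real_alpha F lam z v = k_part (maurer_cartan F z v) + Re lam *\<^sub>R p_part (maurer_cartan F z v)
     - Im lam *\<^sub>R p_part (maurer_cartan F z (\<i> * v))"

lemma inverse_unit: "norm lam = 1 \<Longrightarrow> inverse lam = cnj lam"
  by (simp add: inverse_complex_def complex_eq_iff norm_complex_def)

lemma alpha_lambda_eq:
  assumes "norm lam = 1"
  shows "alpha_lambda F lam z v = cmat (real_alpha F lam z v)"
  unfolding alpha_lambda_def inverse_unit[OF assms]
  by (simp add: vec_eq_iff real_alpha_def cmat_def cscale_def part10_def part01_def
      map_matrix_def complex_eq_iff) (simp add: field_simps)

lemma cmat_mult: "cmat A ** cmat B = cmat (A ** B)"
  by (simp add: cmat_def map_matrix_def matrix_matrix_mult_def vec_eq_iff)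

lemma cmat_inject: "cmat A = cmat B \<longleftrightarrow> A = B"
  by (simp add: cmat_def map_matrix_def vec_eq_iff)

lemma extended_frame_has_derivative:
  assumes "extended_frame D z0 F Fx" "norm lam = 1" "z \<in> D"
  shows "((\<lambda>p. Fx p lam) has_derivative (\<lambda>v. Fx z lam ** real_alpha F lam z v)) (at z)"
proof -
  have d: "(\<lambda>p. Fx p lam) differentiable (at z)"
    and e: "cmat (frechet_derivative (\<lambda>p. Fx p lam) (at z) v)
        = cmat (Fx z lam) ** alpha_lambda F lam z v" for v
    using assms by (auto simp: extended_frame_def)
  have "frechet_derivative (\<lambda>p. Fx p lam) (at z) = (\<lambda>v. Fx z lam ** real_alpha F lam z v)"
    using e by (simp add: alpha_lambda_eq[OF assms(2)] cmat_mult cmat_inject fun_eq_iff)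
  then show ?thesis using d frechet_derivative_works by metis
qed

text \<open>The twisting condition at the level of forms: \<open>lam\<close> multiplies p-parts
  only, and these change sign under \<open>sigma\<close>.\<close>

lemma sigma_real_alpha: "sigma (real_alpha F lam z v) = real_alpha F (- lam) z v"
  by (simp add: real_alpha_def linear_add[OF linear_sigma] linear_diff[OF linear_sigma]
      linear_cmul[OF linear_sigma] sigma_p_part sigma_k_part)

lemma real_alpha_skew:
  assumes "open D" "z \<in> D" "\<And>p. p \<in> D \<Longrightarrow> lorentz_matrix (Inl 1) (F p)" "F differentiable (at z)"
  shows "lorentz_skew (Inl 1) (real_alpha F lam z v)"
  unfolding real_alpha_def
  by (intro lorentz_skew_add lorentz_skew_diff lorentz_skew_scaleR lorentz_skew_p_part
      lorentz_skew_k_part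
      maurer_cartan_skew[of D] assms)

text \<open>Collects the arguments that rest on the differential equation alone. The Gauss map
  enters them only through a relation \<open>F (\<mu> z) = S ** F z ** k z\<close>. Continuity of
  the derivative of \<open>F\<close> serves to bound the form along segments.\<close>

locale lorentz_extended_frame =
  fixes D :: "complex set" and z0 :: complex and F :: "complex \<Rightarrow> real ^ (4 + 'n::finite) ^ (4 + 'n)"
    and Fx :: "complex \<Rightarrow> complex \<Rightarrow> real ^ (4 + 'n) ^ (4 + 'n)"
  assumes D: "open D" "convex D" "z0 \<in> D"
    and F_lorentz: "\<And>z. z \<in> D \<Longrightarrow> lorentz_matrix (Inl 1) (F z)"
    and F_diff: "\<And>z. z \<in> D \<Longrightarrow> F differentiable (at z)"
    and F_C1: "\<And>v. continuous_on D (\<lambda>z. frechet_derivative F (at z) v)"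
    and ext: "extended_frame D z0 F Fx"
begin

lemma ext_derivative:
  "norm lam = 1 \<Longrightarrow> z \<in> D \<Longrightarrow> ((\<lambda>p. Fx p lam) has_derivative (\<lambda>v. Fx z lam ** real_alpha F lam z v))
      (at z)"
  using ext by (rule extended_frame_has_derivative)

lemma alpha_skew: "z \<in> D \<Longrightarrow> lorentz_skew (Inl 1) (real_alpha F lam z v)"
  by (rule real_alpha_skew[of D]) (auto intro: D F_lorentz F_diff)

lemma ext_initial: "norm lam = 1 \<Longrightarrow> Fx z0 lam = mat 1"
  using ext by (simp add: extended_frame_def)

text \<open>This is \<open>ode_product_constant\<close> with both solutions equal: the product keeps
  its value at \<open>z0\<close>.\<close>

lemma extended_frame_lorentz:
  assumes "norm lam = 1" "z \<in> D"
  shows "lorentz_matrix (Inl 1) (Fx z lam)"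
  using ode_product_constant[OF D(2) ext_derivative[OF assms(1)] ext_derivative[OF assms(1)]
      alpha_skew assms(2) D(3)]
  by (intro lorentz_matrix_if_transpose) (simp add: ext_initial[OF assms(1)])

lemma extended_frame_continuous: "norm lam = 1 \<Longrightarrow> continuous_on D (\<lambda>z. Fx z lam)"
  using has_derivative_continuous[OF ext_derivative]
      by (auto intro: continuous_at_imp_continuous_on)

text \<open>The time component of the image of a forward null vector has no zero on the connected
  set \<open>D\<close> and is positive at \<open>z0\<close>.\<close>

lemma extended_frame_O_plus:
  assumes lam: "norm lam = 1" and z: "z \<in> D"
  shows "Fx z lam \<in> O_plus (Inl 1)"
proof (rule O_plusI)
  show "lorentz_matrix (Inl 1) (Fx z lam)" using assms by (rule extended_frame_lorentz)
  fix x :: "real ^ (4 + 'n)" assume x: "x \<in> forward_cone (Inl 1)"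
  let ?g = "\<lambda>z. (Fx z lam *v x) $ Inl 1"
  have "continuous_on D ?g"
    unfolding matrix_vector_mult_def using extended_frame_continuous[OF lam]
    by (auto intro!: continuous_intros)
  then have conn: "connected (?g ` D)" using D(2)
      by (intro connected_continuous_image convex_connected)
  show "?g z > 0"
  proof (rule ccontr)
    assume "\<not> ?g z > 0"
    moreover have "?g z0 > 0" using forward_coneD[OF x] by (simp add: ext_initial[OF lam])
    ultimately have "0 \<in> ?g ` D"
      using conn z D(3) unfolding connected_iff_interval by (auto simp: not_less intro: less_imp_le)
    then show False using lorentz_time_nonzero[OF extended_frame_lorentz[OF lam] x] by auto
  qed
qed

text \<open>As \<open>sigma\<close> is multiplicative and turns the form for \<open>lam\<close> into
  the form for \<open>- lam\<close>, both sides solve the same equation with the identity as initial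
  value.\<close>

lemma sigma_extended_frame:
  assumes lam: "norm lam = 1" and z: "z \<in> D"
  shows "sigma (Fx z lam) = Fx z (- lam)"
proof -
  have lam': "norm (- lam) = 1" using lam by simp
  have bl: "bounded_linear sigma" using linear_sigma linear_conv_bounded_linear by blast
  have "((\<lambda>p. sigma (Fx p lam)) has_derivative (\<lambda>v. sigma (Fx z lam) ** real_alpha F (- lam) z v))
      (at z)" if "z \<in> D" for z
    using bounded_linear.has_derivative[OF bl ext_derivative[OF lam that]]
        by (simp add: sigma_mult sigma_real_alpha)
  from ode_product_constant[OF D(2) this ext_derivative[OF lam'] alpha_skew z D(3)]
  have "sigma (Fx z lam) ** minkowski (Inl 1) ** transpose (Fx z (- lam)) = minkowski (Inl 1)"
    by (simp add: ext_initial lam sigma_eq sigma_matrix_square)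
  from lorentz_product_solve[OF this extended_frame_lorentz[OF lam' z]] show ?thesis by simp
qed

lemma maurer_cartan_continuous: "continuous_on D (\<lambda>z. maurer_cartan F z v)"
proof -
  have "continuous_on D F"
    by (simp add: F_diff continuous_at_imp_continuous_on differentiable_imp_continuous_within)
  then have "continuous_on D (\<lambda>z. lorentz_inv (Inl 1) (F z) ** frechet_derivative F (at z) v)"
    by (intro continuous_on_matrix_mult F_C1
        bounded_linear.continuous_on[OF bounded_linear_lorentz_inv])
  then show ?thesis
    by (rule continuous_on_eq) (simp add: maurer_cartan_def matrix_inv_lorentz[OF F_lorentz])
qed

text \<open>
  For fixed \<open>\<lambda>\<^sub>1\<close> the quotient \<open>W\<close> of the solutions for \<open>\<lambda>\<close> and \<open>\<lambda>\<^sub>1\<close> along a segment satisfies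
  \<open>W' = W B\<close> with \<open>B = O(\<bar>\<lambda> - \<lambda>\<^sub>1\<bar>)\<close>; comparing with the maximum of \<open>norm W\<close> gives
  \<open>W \<rightarrow> I\<close> without Gronwall's inequality.
\<close>

lemma extended_frame_continuous_parameter:
  assumes z: "z \<in> D"
  shows "continuous_on (sphere 0 1) (\<lambda>lam. Fx z lam)"
proof -
  obtain K where K: "K > 0" "\<And>(X :: real ^ (4 + 'n) ^ (4 + 'n)) (Z :: real ^ (4 + 'n) ^ (4 + 'n)).
      norm (X ** Z) \<le> norm X * norm Z * K"
    using bounded_bilinear.pos_bounded[OF bounded_bilinear_matrix_mult] by blast
  define \<gamma> where "\<gamma> = (\<lambda>t::real. z0 + t *\<^sub>R (z - z0))"
  have \<gamma>D: "\<gamma> t \<in> D" if "t \<in> {0..1}" for t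
  proof -
    have "\<gamma> t = (1 - t) *\<^sub>R z0 + t *\<^sub>R z" by (simp add: \<gamma>_def algebra_simps)
    then show ?thesis using convexD_alt[OF D(2,3) z, of t] that by simp
  qed
  have \<gamma>d: "(\<gamma> has_derivative (\<lambda>h. h *\<^sub>R (z - z0))) (at t within {0..1})" for t
    unfolding \<gamma>_def by (auto intro!: derivative_eq_intros)
  have \<gamma>c: "continuous_on {0..1} \<gamma>" unfolding \<gamma>_def by (intro continuous_intros)
  have "continuous (at lam1 within sphere 0 1) (\<lambda>lam. Fx z lam)" if "lam1 \<in> sphere 0 1" for lam1
  proof -
    have lam1: "norm lam1 = 1" using that by simp
    let ?inv = "\<lambda>t. lorentz_inv (Inl 1) (Fx (\<gamma> t) lam1)"
    \<comment> \<open>Only the solution for \<open>lam1\<close> occurs here, so the bounds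
      \<open>C1\<close> and \<open>C2\<close> below are uniform in \<open>lam\<close>.\<close>
    let ?B = "\<lambda>c t. Fx (\<gamma> t) lam1 ** p_part (maurer_cartan F (\<gamma> t) (c * (z - z0))) ** ?inv t"
    have "bounded (?B c ` {0..1})" for c
    proof -
      have bl: "bounded_linear p_part" using linear_p_part linear_conv_bounded_linear by blast
      have comp: "continuous_on {0..1} (\<lambda>t. g (\<gamma> t))" if "continuous_on D g"
          for g :: "complex \<Rightarrow> real ^ (4 + 'n) ^ (4 + 'n)"
        using that \<gamma>c \<gamma>D by (auto intro!: continuous_on_compose2[of D g])
      have "continuous_on {0..1} (?B c)"
        by (intro continuous_on_matrix_mult bounded_linear.continuous_on[OF bl]
            bounded_linear.continuous_on[OF bounded_linear_lorentz_inv] comp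
                extended_frame_continuous lam1 maurer_cartan_continuous)
      then show ?thesis using compact_continuous_image compact_imp_bounded compact_Icc by blast
    qed
    then obtain C1 C2 where C1: "\<And>t. t \<in> {0..1} \<Longrightarrow> norm (?B 1 t) \<le> C1" and C2: "\<And>t. t \<in> {0..1}
        \<Longrightarrow> norm (?B \<i> t) \<le> C2"
      unfolding bounded_iff by blast
    define C where "C = \<bar>C1\<bar> + \<bar>C2\<bar>"
    define I :: "real ^ (4 + 'n) ^ (4 + 'n)" where "I = mat 1"
    \<comment> \<open>The bound \<open>1/2\<close> allows the maximal norm of the quotient to be
      absorbed later; the factor 2 in the conclusion is the price.\<close>
    have main: "norm (Fx z lam ** ?inv 1 - I) \<le> 2 * (C * norm (lam - lam1) * K) * norm I"
      if lam: "norm lam = 1" and small: "C * norm (lam - lam1) * K \<le> 1/2" for lam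
    proof -
      let ?W = "\<lambda>t. Fx (\<gamma> t) lam ** ?inv t"
      let ?dW = "\<lambda>t. ?W t ** ((Re lam - Re lam1) *\<^sub>R ?B 1 t - (Im lam - Im lam1) *\<^sub>R ?B \<i> t)"
      have dW: "(?W has_derivative (\<lambda>h. h *\<^sub>R ?dW t)) (at t within {0..1})" if t: "t \<in> {0..1}" for t
      proof -
        let ?G = "Fx (\<gamma> t) lam" and ?H = "Fx (\<gamma> t) lam1"
        let ?A = "real_alpha F lam (\<gamma> t)" and ?A1 = "real_alpha F lam1 (\<gamma> t)"
        note H = extended_frame_lorentz[OF lam1 \<gamma>D[OF t]]
        have lin: "linear (\<lambda>v. ?G ** ?A v)" "linear (\<lambda>v. ?H ** ?A1 v)"
          using ext_derivative[OF lam \<gamma>D[OF t]] ext_derivative[OF lam1 \<gamma>D[OF t]]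
              has_derivative_linear by blast+
        have dG: "((\<lambda>t. Fx (\<gamma> t) lam) has_derivative (\<lambda>h. h *\<^sub>R (?G ** ?A (z - z0))))
            (at t within {0..1})"
          using has_derivative_compose[OF \<gamma>d ext_derivative[OF lam \<gamma>D[OF t]]]
              linear_cmul[OF lin(1)] by simp
        have dH: "((\<lambda>t. Fx (\<gamma> t) lam1) has_derivative (\<lambda>h. h *\<^sub>R (?H ** ?A1 (z - z0))))
            (at t within {0..1})"
          using has_derivative_compose[OF \<gamma>d ext_derivative[OF lam1 \<gamma>D[OF t]]]
              linear_cmul[OF lin(2)] by simp
        have dW: "(?W has_derivative (\<lambda>h. ?G ** lorentz_inv (Inl 1) (h *\<^sub>R (?H ** ?A1 (z - z0)))
            + h *\<^sub>R (?G ** ?A (z - z0)) ** ?inv t)) (at t within {0..1})"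
          by (intro has_derivative_matrix_mult dG
              bounded_linear.has_derivative[OF bounded_linear_lorentz_inv] dH)
        \<comment> \<open>Being linear, \<open>lorentz_inv\<close> is applied to the derivative
          itself; skewness turns the result into the usual formula for the derivative of an
          inverse.\<close>
        have "lorentz_inv (Inl 1) (?H ** ?A1 (z - z0)) = - (?A1 (z - z0) ** ?inv t)"
        proof -
          have "?A1 (z - z0) ** minkowski (Inl 1) + minkowski (Inl 1) ** transpose (?A1 (z - z0))
              = 0"
            using alpha_skew[OF \<gamma>D[OF t]] by (simp add: lorentz_skew_def)
          then have "minkowski (Inl 1) ** transpose (?A1 (z - z0))
              = - (?A1 (z - z0) ** minkowski (Inl 1))"
            by (simp add: add_eq_0_iff)
          then show ?thesis by (simp add: lorentz_inv_def matrix_transpose_mul matrix_mul_assoc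
              matrix_mult_linear)
        qed
        then have "?G ** lorentz_inv (Inl 1) (h *\<^sub>R (?H ** ?A1 (z - z0)))
            + h *\<^sub>R (?G ** ?A (z - z0)) ** ?inv t
            = h *\<^sub>R (?G ** (?A (z - z0) - ?A1 (z - z0)) ** ?inv t)" for h
          by (simp add: linear_cmul[OF linear_lorentz_inv] matrix_mult_linear matrix_mul_assoc
              algebra_simps)
        moreover have "?G ** (?A (z - z0) - ?A1 (z - z0)) ** ?inv t = ?dW t"
        proof -
          \<comment> \<open>The k-parts do not involve the parameter and cancel in the difference of
            the two forms, leaving p-parts with the small coefficients.\<close>
          have "?dW t = ?G ** ?inv t ** ?H ** (?A (z - z0) - ?A1 (z - z0)) ** ?inv t"
            by (simp add: real_alpha_def matrix_mult_linear matrix_mul_assoc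
                scaleR_left_diff_distrib)
          then show ?thesis by (simp add: lorentz_matrix_cancel_right[OF H])
        qed
        ultimately show ?thesis using dW by simp
      qed
      have "continuous_on {0..1} ?W"
        by (rule has_derivative_continuous_on[OF dW])
      then have "compact ((\<lambda>t. norm (?W t)) ` {0..1})"
        by (intro compact_continuous_image continuous_on_norm) auto
      then obtain t1 where t1: "t1 \<in> {0..1}" "\<And>t. t \<in> {0..1} \<Longrightarrow> norm (?W t) \<le> norm (?W t1)"
        using compact_attains_sup[of "(\<lambda>t. norm (?W t)) ` {0..1}"] by auto
      define m \<epsilon> where "m = norm (?W t1)" and "\<epsilon> = C * norm (lam - lam1) * K"
      have bound: "norm (?dW t) \<le> m * \<epsilon>" if t: "t \<in> {0..1}" for t
      proof -
        have "norm ((Re lam - Re lam1) *\<^sub>R ?B 1 t - (Im lam - Im lam1) *\<^sub>R ?B \<i> t)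
            \<le> \<bar>Re lam - Re lam1\<bar> * norm (?B 1 t) + \<bar>Im lam - Im lam1\<bar> * norm (?B \<i> t)"
          by (rule order_trans[OF norm_triangle_ineq4]) simp
        also have "\<dots> \<le> norm (lam - lam1) * \<bar>C1\<bar> + norm (lam - lam1) * \<bar>C2\<bar>"
          using C1[OF t] C2[OF t] abs_Re_le_cmod[of "lam - lam1"] abs_Im_le_cmod[of "lam - lam1"]
          by (intro add_mono mult_mono) auto
        also have "\<dots> = C * norm (lam - lam1)" by (simp add: C_def algebra_simps)
        finally have B: "norm ((Re lam - Re lam1) *\<^sub>R ?B 1 t - (Im lam - Im lam1) *\<^sub>R ?B \<i> t) \<le> C
            * norm (lam - lam1)" .
        have "norm (?dW t) \<le> norm (?W t) * norm
            ((Re lam - Re lam1) *\<^sub>R ?B 1 t - (Im lam - Im lam1) *\<^sub>R ?B \<i> t) * K"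
          by (rule K(2))
        also have "\<dots> \<le> m * (C * norm (lam - lam1)) * K"
          using t1(2)[OF t] B K(1) by (intro mult_right_mono mult_mono) (auto simp: m_def)
        finally show ?thesis by (simp add: \<epsilon>_def mult_ac)
      qed
      have diff: "norm (?W t - I) \<le> m * \<epsilon>" if t: "t \<in> {0..1}" for t
      proof -
        have "norm (?W t - ?W 0) \<le> (m * \<epsilon>) * norm (t - 0)"
        proof (rule differentiable_bound[OF convex_closed_interval _ _ t])
          show "(?W has_derivative (\<lambda>h. h *\<^sub>R ?dW s)) (at s within {0..1})" if "s \<in> {0..1}" for s
              by (rule dW[OF that])
          show "onorm (\<lambda>h. h *\<^sub>R ?dW s) \<le> m * \<epsilon>" if "s \<in> {0..1}" for s
            using bound[OF that] norm_ge_zero[of "?dW s"]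
            by (intro onorm_bound) (auto simp: mult.commute intro!: mult_left_mono simp del:
                norm_ge_zero)
        qed auto
        moreover have "?W 0 = I"
          by (simp add: \<gamma>_def ext_initial lam lam1 I_def lorentz_inv_def)
        moreover have "(m * \<epsilon>) * norm (t - 0) \<le> m * \<epsilon> * 1"
          using t bound[OF t] norm_ge_zero[of "?dW t"]
              by (intro mult_left_mono) (auto simp del: norm_ge_zero)
        ultimately show ?thesis by simp
      qed
      \<comment> \<open>The maximum \<open>m\<close> is bounded in terms of \<open>m / 2\<close>,
        which yields a bound independent of \<open>lam\<close>.\<close>
      have "m \<le> norm I + norm (?W t1 - I)" unfolding m_def by (rule norm_triangle_sub)
      also have "\<dots> \<le> norm I + m * (1/2)"
        using diff[OF t1(1)] small mult_left_mono[of \<epsilon> "1/2" m] by (simp add: \<epsilon>_def m_def)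
      finally have "m \<le> 2 * norm I" by simp
      moreover have "0 \<le> \<epsilon>" using K(1) by (simp add: \<epsilon>_def C_def)
      ultimately have "m * \<epsilon> \<le> 2 * norm I * \<epsilon>" by (intro mult_right_mono)
      moreover have "norm (?W 1 - I) \<le> m * \<epsilon>" by (rule diff) simp
      ultimately show ?thesis by (simp add: \<gamma>_def \<epsilon>_def mult_ac)
    qed
    have lim: "((\<lambda>lam. C * norm (lam - lam1) * K) \<longlongrightarrow> C * norm (lam1 - lam1) * K)
        (at lam1 within sphere 0 1)"
      by (intro tendsto_intros)
    then have "\<forall>\<^sub>F lam in at lam1 within sphere 0 1. C * norm (lam - lam1) * K < 1/2"
      by (rule order_tendstoD) simp
    moreover have "\<forall>\<^sub>F lam in at lam1 within sphere 0 1. lam \<in> sphere 0 1"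
      by (simp add: eventually_at_filter)
    ultimately have "\<forall>\<^sub>F lam in at lam1 within sphere 0 1.
        norm (Fx z lam ** ?inv 1 - I) \<le> 2 * (C * norm (lam - lam1) * K) * norm I"
      by eventually_elim (rule main; simp)
    moreover have "((\<lambda>lam. 2 * (C * norm (lam - lam1) * K) * norm I) \<longlongrightarrow> 0)
        (at lam1 within sphere 0 1)"
      by (auto intro!: tendsto_eq_intros)
    ultimately have "((\<lambda>lam. Fx z lam ** ?inv 1 - I) \<longlongrightarrow> 0) (at lam1 within sphere 0 1)"
      by (rule Lim_null_comparison)
    then have "((\<lambda>lam. Fx z lam ** ?inv 1) \<longlongrightarrow> I) (at lam1 within sphere 0 1)"
      by (simp add: Lim_null[symmetric])
    then have "((\<lambda>lam. Fx z lam ** ?inv 1 ** Fx z lam1) \<longlongrightarrow> I ** Fx z lam1)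
        (at lam1 within sphere 0 1)"
      by (intro bounded_bilinear.tendsto[OF bounded_bilinear_matrix_mult] tendsto_const)
    moreover have "\<gamma> 1 = z" by (simp add: \<gamma>_def)
    ultimately show ?thesis
      by (simp add: continuous_within I_def
          lorentz_matrix_cancel_right[OF extended_frame_lorentz[OF lam1 z]])
  qed
  then show ?thesis by (simp add: continuous_on_eq_continuous_within)
qed

lemma frame_has_derivative:
  "z \<in> D \<Longrightarrow> (F has_derivative (\<lambda>v. F z ** maurer_cartan F z v)) (at z)"
  using F_diff[of z] unfolding frechet_derivative_works
  by (simp add: maurer_cartan_def matrix_inv_lorentz[OF F_lorentz]
      lorentz_matrix_cancel[OF F_lorentz])

lemma maurer_cartan_minus: "z \<in> D \<Longrightarrow> maurer_cartan F z (- v) = - maurer_cartan F z v"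
  using has_derivative_linear[OF F_diff[of z, unfolded frechet_derivative_works]]
  by (simp add: maurer_cartan_def linear_neg matrix_mult_linear)

text \<open>
  The gauge transformation by \<open>k\<close> conjugates \<open>\<alpha>\<^sub>\<pp>\<close>, and pulling back by an antiholomorphic map
  interchanges its \<open>(1,0)\<close>- and \<open>(0,1)\<close>-parts, which amounts to \<open>\<lambda> \<mapsto> \<lambda>\<^sup>-\<^sup>1\<close>.
\<close>

lemma extended_frame_antiholomorphic_symmetry:
  assumes \<mu>D: "\<And>z. z \<in> D \<Longrightarrow> \<mu> z \<in> D"
    and d\<mu>: "\<And>z. z \<in> D \<Longrightarrow> (\<mu> has_derivative m z) (at z)"
    and anti: "\<And>z v. z \<in> D \<Longrightarrow> m z (\<i> * v) = - \<i> * m z v"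
    and S: "lorentz_matrix (Inl 1) S"
    and k: "\<And>z. z \<in> D \<Longrightarrow> lorentz_matrix (Inl 1) (k z)" and sk: "\<And>z. z \<in> D \<Longrightarrow> sigma (k z) = k z"
    and eq: "\<And>z. z \<in> D \<Longrightarrow> F (\<mu> z) = S ** F z ** k z"
    and lam: "norm lam = 1" and z: "z \<in> D"
  shows "Fx (\<mu> z) lam = Fx (\<mu> z0) lam ** lorentz_inv (Inl 1) (k z0) ** Fx z (inverse lam) ** k z"
proof -
  have lam': "norm (inverse lam) = 1" using lam by (simp add: norm_inverse)
  let ?\<beta> = "\<lambda>z v. real_alpha F lam (\<mu> z) (m z v)"
  let ?kd = "\<lambda>z. frechet_derivative k (at z)"
  have G: "((\<lambda>p. Fx (\<mu> p) lam) has_derivative (\<lambda>v. Fx (\<mu> z) lam ** ?\<beta> z v)) (at z)" if "z \<in> D" for z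
    using has_derivative_compose[OF d\<mu>[OF that] ext_derivative[OF lam \<mu>D[OF that]]] .
  have F\<mu>: "((\<lambda>p. F (\<mu> p)) has_derivative (\<lambda>v. F (\<mu> z) ** maurer_cartan F (\<mu> z) (m z v))) (at z)"
      if "z \<in> D" for z
    using has_derivative_compose[OF d\<mu>[OF that] frame_has_derivative[OF \<mu>D[OF that]]] .
  have SF: "((\<lambda>p. S ** F p) has_derivative (\<lambda>v. S ** (F z ** maurer_cartan F z v))) (at z)"
      if "z \<in> D" for z
    by (intro bounded_linear.has_derivative[OF
        bounded_bilinear.bounded_linear_right[OF bounded_bilinear_matrix_mult]]
        frame_has_derivative that)
  have SFL: "lorentz_matrix (Inl 1) (S ** F z)" if "z \<in> D" for z
    using S F_lorentz[OF that] by (rule lorentz_matrix_mult)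
  \<comment> \<open>Differentiability of \<open>k\<close> is obtained by solving the symmetry
    relation for \<open>k\<close>.\<close>
  have kd: "(k has_derivative ?kd z) (at z)" if z: "z \<in> D" for z
  proof -
    have "(\<lambda>p. lorentz_inv (Inl 1) (S ** F p) ** F (\<mu> p)) differentiable (at z)"
      unfolding differentiable_def
      using has_derivative_matrix_mult[OF
          bounded_linear.has_derivative[OF bounded_linear_lorentz_inv SF[OF z]] F\<mu>[OF z]] by blast
    then obtain d where "((\<lambda>p. lorentz_inv (Inl 1) (S ** F p) ** F (\<mu> p)) has_derivative d) (at z)"
      unfolding differentiable_def by blast
    then have "(k has_derivative d) (at z)"
      by (rule has_derivative_transform_within_open[OF _ D(1) z])
         (simp add: eq lorentz_matrix_cancel[OF SFL])
    then show ?thesis using frechet_derivative_at by metis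
  qed
  have skd: "sigma (?kd z v) = ?kd z v" if z: "z \<in> D" for z v
  proof -
    have bl: "bounded_linear sigma" using linear_sigma linear_conv_bounded_linear by blast
    have "((\<lambda>p. sigma (k p)) has_derivative ?kd z) (at z)"
      by (rule has_derivative_transform_within_open[OF kd[OF z] D(1) z]) (simp add: sk)
    moreover have "((\<lambda>p. sigma (k p)) has_derivative (\<lambda>v. sigma (?kd z v))) (at z)"
      by (rule bounded_linear.has_derivative[OF bl kd[OF z]])
    ultimately have "?kd z = (\<lambda>v. sigma (?kd z v))" by (rule has_derivative_unique)
    then show ?thesis by metis
  qed
  \<comment> \<open>The symmetry relation differentiated, with the invertible factor
    \<open>S ** F z\<close> cancelled: the usual gauge transformation rule.\<close>
  have gauge: "k z ** maurer_cartan F (\<mu> z) (m z v) = ?kd z v + maurer_cartan F z v ** k z"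
      if z: "z \<in> D" for z v
  proof -
    have "((\<lambda>p. S ** F p ** k p) has_derivative
        (\<lambda>v. S ** F z ** ?kd z v + S ** (F z ** maurer_cartan F z v) ** k z)) (at z)"
      by (rule has_derivative_matrix_mult[OF SF[OF z] kd[OF z]])
    moreover have "((\<lambda>p. S ** F p ** k p)
        has_derivative (\<lambda>v. F (\<mu> z) ** maurer_cartan F (\<mu> z) (m z v))) (at z)"
      by (rule has_derivative_transform_within_open[OF F\<mu>[OF z] D(1) z]) (simp add: eq)
    ultimately have "(\<lambda>v. S ** F z ** ?kd z v + S ** (F z ** maurer_cartan F z v) ** k z)
        = (\<lambda>v. F (\<mu> z) ** maurer_cartan F (\<mu> z) (m z v))" by (rule has_derivative_unique)
    then have "S ** F z ** ?kd z v + S ** (F z ** maurer_cartan F z v) ** k z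
        = F (\<mu> z) ** maurer_cartan F (\<mu> z) (m z v)" by (rule fun_cong)
    then have "S ** F z ** (k z ** maurer_cartan F (\<mu> z) (m z v))
        = S ** F z ** (?kd z v + maurer_cartan F z v ** k z)"
      by (simp add: eq[OF z] matrix_mult_linear matrix_mul_assoc)
    then show ?thesis using lorentz_matrix_cancel(1)[OF SFL[OF z]] by metis
  qed
  \<comment> \<open>The inhomogeneous term of the gauge rule is fixed by \<open>sigma\<close> and
    lands in the k-part. The p-part transforms by conjugation alone and so tolerates the factors
    coming from \<open>lam\<close>.\<close>
  have gp: "k z ** p_part (maurer_cartan F (\<mu> z) (m z v)) = p_part (maurer_cartan F z v) ** k z"
    and gk: "k z ** k_part (maurer_cartan F (\<mu> z) (m z v)) = ?kd z v
        + k_part (maurer_cartan F z v) ** k z"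
    if z: "z \<in> D" for z v
  proof -
    have s1: "sigma (mat 1) = mat 1" by (simp add: sigma_eq sigma_matrix_square)
    have kdv: "p_part (?kd z v) = 0" "k_part (?kd z v) = ?kd z v"
      using skd[OF z, of v] by (simp_all add: p_part_eq_0_iff k_part_eq_iff)
    show "k z ** p_part (maurer_cartan F (\<mu> z) (m z v)) = p_part (maurer_cartan F z v) ** k z"
      using arg_cong[OF gauge[OF z, of v], of p_part] p_part_conjugate[OF sk[OF z] s1]
          p_part_conjugate[OF s1 sk[OF z]]
      by (simp add: linear_add[OF linear_p_part] kdv)
    show "k z ** k_part (maurer_cartan F (\<mu> z) (m z v)) = ?kd z v
        + k_part (maurer_cartan F z v) ** k z"
      using arg_cong[OF gauge[OF z, of v], of k_part] k_part_conjugate[OF sk[OF z] s1]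
          k_part_conjugate[OF s1 sk[OF z]]
      by (simp add: linear_add[OF linear_k_part] kdv)
  qed
  have alpha: "k z ** ?\<beta> z v = ?kd z v + real_alpha F (inverse lam) z v ** k z" if z: "z \<in> D"
      for z v
  proof -
    have "linear (m z)" using d\<mu>[OF z] by (rule has_derivative_linear)
    \<comment> \<open>Conjugate linearity flips the sign of the \<open>Im lam\<close> term, which
      replaces \<open>lam\<close> by \<open>cnj lam\<close>, that is, by
      \<open>inverse lam\<close>.\<close>
    then have im: "\<i> * m z v = m z (- (\<i> * v))" by (simp add: linear_neg anti[OF z])
    have "k z ** p_part (maurer_cartan F (\<mu> z) (\<i> * m z v))
        = - p_part (maurer_cartan F z (\<i> * v)) ** k z"
      unfolding im by (simp add: gp[OF z] maurer_cartan_minus[OF z] linear_neg[OF linear_p_part])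
    then show ?thesis
      by (simp add: real_alpha_def inverse_unit[OF lam] matrix_mult_linear gp[OF z] gk[OF z])
  qed
  have H: "((\<lambda>p. Fx p (inverse lam) ** k p)
      has_derivative (\<lambda>v. (Fx z (inverse lam) ** k z) ** ?\<beta> z v)) (at z)" if z: "z \<in> D" for z
  proof -
    have "Fx z (inverse lam) ** ?kd z v + Fx z (inverse lam) ** real_alpha F (inverse lam) z v **
        k z
        = (Fx z (inverse lam) ** k z) ** ?\<beta> z v" for v
      using alpha[OF z, of v] by (simp add: matrix_mult_linear flip: matrix_mul_assoc)
    then show ?thesis using has_derivative_matrix_mult[OF ext_derivative[OF lam' z] kd[OF z]]
        by simp
  qed
  \<comment> \<open>The constant product is evaluated at \<open>z0\<close>, where the extended frame
    is the identity; this produces the left factor.\<close>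
  have "Fx (\<mu> z) lam ** minkowski (Inl 1) ** transpose (Fx z (inverse lam) ** k z)
      = Fx (\<mu> z0) lam ** minkowski (Inl 1) ** transpose (Fx z0 (inverse lam) ** k z0)"
    by (rule ode_product_constant[OF D(2) G H alpha_skew[OF \<mu>D] z D(3)])
  from lorentz_product_solve[OF this lorentz_matrix_mult[OF extended_frame_lorentz[OF lam' z]
      k[OF z]]]
  show ?thesis by (simp add: ext_initial[OF lam'] lorentz_inv_def matrix_mul_assoc)
qed

end

section \<open>Second derivatives of the canonical lift\<close>

lemma smooth_map_on_differentiable:
  assumes "smooth_map_on U g" "x \<in> U"
  shows "g differentiable (at x)" "(\<lambda>p. frechet_derivative g (at p) v) differentiable (at x)"
proof -
  have "Ck_map_on 1 U g" "Ck_map_on (Suc (Suc 0)) U g" using assms(1) unfolding smooth_map_on_def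
      by blast+
  then show "g differentiable (at x)" "(\<lambda>p. frechet_derivative g (at p) v) differentiable (at x)"
    using assms(2) by auto
qed

lemma smooth_map_on_C1: "smooth_map_on U g \<Longrightarrow> continuous_on U (\<lambda>p. frechet_derivative g (at p) v)"
  unfolding smooth_map_on_def by (drule spec[of _ "Suc 0"]) simp

lemma has_derivative_partial_sum:
  assumes "(g has_derivative g') F"
  shows "g' v = Re v *\<^sub>R g' 1 + Im v *\<^sub>R g' \<i>"
proof -
  have l: "linear g'" using assms by (rule has_derivative_linear)
  have "v = Re v *\<^sub>R 1 + Im v *\<^sub>R \<i>" by (simp add: complex_eq_iff)
  then have "g' v = g' (Re v *\<^sub>R 1 + Im v *\<^sub>R \<i>)" by (rule arg_cong)
  then show ?thesis by (simp only: linear_add[OF l] linear_cmul[OF l])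
qed

lemma vd_z_cvec:
  assumes "Y differentiable (at z)"
  shows "vd_z (\<lambda>p. cvec (Y p)) z $ i =
    (complex_of_real (frechet_derivative Y (at z) 1 $ i) - \<i> * complex_of_real
        (frechet_derivative Y (at z) \<i> $ i)) / 2"
proof -
  have "((\<lambda>p. complex_of_real (Y p $ i))
      has_derivative (\<lambda>v. complex_of_real (frechet_derivative Y (at z) v $ i))) (at z)"
    using assms unfolding frechet_derivative_works
    by (intro has_derivative_of_real bounded_linear.has_derivative[OF bounded_linear_vec_nth])
  from frechet_derivative_at[OF this, symmetric]
  show ?thesis by (simp add: vd_z_def d_z_def cvec_def partial_x_def partial_y_def)
qed

lemma Re_vd_z_cvec: "Y differentiable (at z) \<Longrightarrow> Re_vec (vd_z (\<lambda>p. cvec (Y p)) z)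
    = (1/2) *\<^sub>R frechet_derivative Y (at z) 1"
  and Im_vd_z_cvec: "Y differentiable (at z) \<Longrightarrow> Im_vec (vd_z (\<lambda>p. cvec (Y p)) z)
      = (- 1/2) *\<^sub>R frechet_derivative Y (at z) \<i>"
  by (simp_all add: vec_eq_iff Re_vec_def Im_vec_def vd_z_cvec)

definition laplacian :: "(complex \<Rightarrow> 'a::real_normed_vector) \<Rightarrow> complex \<Rightarrow> 'a" where
  "laplacian Y z = frechet_derivative (\<lambda>p. frechet_derivative Y (at p) 1) (at z) 1
     + frechet_derivative (\<lambda>p. frechet_derivative Y (at p) \<i>) (at z) \<i>"

lemma Re_vd_zbar_vd_z:
  assumes "open D" "z \<in> D" and Y: "smooth_map_on D Y"
  shows "Re_vec (vd_zbar (vd_z (\<lambda>p. cvec (Y p))) z) = (1/4) *\<^sub>R laplacian Y z"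
proof -
  let ?X = "\<lambda>p. frechet_derivative Y (at p) 1" and ?W = "\<lambda>p. frechet_derivative Y (at p) \<i>"
  let ?dX = "frechet_derivative ?X (at z)" and ?dW = "frechet_derivative ?W (at z)"
  have dX: "(?X has_derivative ?dX) (at z)" and dW: "(?W has_derivative ?dW) (at z)"
    using smooth_map_on_differentiable(2)[OF Y \<open>z \<in> D\<close>] frechet_derivative_works by blast+
  have "Re (d_zbar (\<lambda>p. vd_z (\<lambda>p. cvec (Y p)) p $ i) z) = laplacian Y z $ i / 4" for i
  proof -
    have "((\<lambda>p. (complex_of_real (?X p $ i) - \<i> * complex_of_real (?W p $ i)) / 2) has_derivative
        (\<lambda>v. (complex_of_real (?dX v $ i) - \<i> * complex_of_real (?dW v $ i)) / 2)) (at z)"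
      by (intro bounded_linear.has_derivative[OF bounded_linear_divide] has_derivative_diff
          bounded_linear.has_derivative[OF bounded_linear_mult_right] has_derivative_of_real
          bounded_linear.has_derivative[OF bounded_linear_vec_nth] dX dW)
    then have "((\<lambda>p. vd_z (\<lambda>p. cvec (Y p)) p $ i) has_derivative
        (\<lambda>v. (complex_of_real (?dX v $ i) - \<i> * complex_of_real (?dW v $ i)) / 2)) (at z)"
      by (rule has_derivative_transform_within_open[OF _ assms(1,2)])
         (simp add: vd_z_cvec smooth_map_on_differentiable(1)[OF Y])
    from frechet_derivative_at[OF this]
    have "frechet_derivative (\<lambda>p. vd_z (\<lambda>p. cvec (Y p)) p $ i) (at z)
        = (\<lambda>v. (complex_of_real (?dX v $ i) - \<i> * complex_of_real (?dW v $ i)) / 2)" ..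
    then show ?thesis by (simp add: d_zbar_def partial_x_def partial_y_def laplacian_def)
  qed
  then show ?thesis by (simp add: vec_eq_iff Re_vec_def vd_zbar_def)
qed

text \<open>The conjugate of \<open>\<mu>\<close> is injective and holomorphic, so its derivative
  has no zero and admits a logarithm on the contractible set \<open>D\<close>. As
  \<open>d_zbar \<mu>\<close> is then \<open>cnj (exp L)\<close>, \<open>Re L\<close> is the
  function \<open>\<tau>\<close> and \<open>- Im L\<close> is one choice of
  \<open>\<theta>\<close>.\<close>

lemma antiholomorphic_log_derivative:
  assumes D: "open D" "convex D" and bij: "bij_betw \<mu> D D"
      and hol: "(\<lambda>z. cnj (\<mu> z)) holomorphic_on D"
  obtains L where "L holomorphic_on D" "\<And>z. z \<in> D
      \<Longrightarrow> (\<mu> has_derivative (\<lambda>v. cnj (exp (L z) * v))) (at z)"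
proof -
  let ?h = "\<lambda>z. cnj (\<mu> z)"
  have inj: "inj_on ?h D" using bij by (auto simp: bij_betw_def inj_on_def)
  have "deriv ?h z \<noteq> 0" if "z \<in> D" for z
    by (rule holomorphic_injective_imp_regular[OF hol D(1) inj that])
  then obtain L where L: "L holomorphic_on D" "\<And>z. z \<in> D \<Longrightarrow> deriv ?h z = exp (L z)"
    using contractible_imp_holomorphic_log[OF holomorphic_deriv[OF hol D(1)]
        convex_imp_contractible[OF D(2)]] by metis
  have "(\<mu> has_derivative (\<lambda>v. cnj (exp (L z) * v))) (at z)" if z: "z \<in> D" for z
  proof -
    have "(?h has_derivative (*) (exp (L z))) (at z)"
      using holomorphic_derivI[OF hol D(1) z, of UNIV] L(2)[OF z]
          by (simp add: has_field_derivative_def)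
    from bounded_linear.has_derivative[OF bounded_linear_cnj this] show ?thesis by simp
  qed
  with L(1) that show ?thesis by blast
qed

lemma d_zbar_antiholomorphic:
  assumes "(\<mu> has_derivative (\<lambda>v. cnj (e * v))) (at z)"
  shows "d_zbar \<mu> z = cnj e"
  using frechet_derivative_at[OF assms, symmetric]
      by (simp add: d_zbar_def partial_x_def partial_y_def complex_eq_iff)

lemma span_4E:
  assumes "x \<in> span {a, b, c, d :: 'a::real_vector}"
  obtains r s t u where "x = r *\<^sub>R a + s *\<^sub>R b + t *\<^sub>R c + u *\<^sub>R d"
proof -
  obtain r s t where "x - r *\<^sub>R a - s *\<^sub>R b - t *\<^sub>R c \<in> span {d}"
    using assms by (auto simp: span_breakdown_eq)
  then obtain u where "x - r *\<^sub>R a - s *\<^sub>R b - t *\<^sub>R c = u *\<^sub>R d"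
    by (auto simp: span_singleton)
  then have "x = r *\<^sub>R a + s *\<^sub>R b + t *\<^sub>R c + u *\<^sub>R d" by (simp add: algebra_simps)
  then show ?thesis by (rule that)
qed

lemma column_matrix_mult: "column j (A ** B) = A *v column j B"
  for A :: "'a::semiring_1 ^ 'n ^ 'm" and B :: "'a ^ 'k ^ 'n"
  by (simp add: column_def matrix_matrix_mult_def matrix_vector_mult_def vec_eq_iff)

lemma bounded_linear_matrix_vector: "bounded_linear ((*v) A)" for A :: "real ^ 'n ^ 'm"
  using matrix_vector_mul_linear linear_conv_bounded_linear by blast

lemmas matrix_vector_linear =
  linear_add[OF matrix_vector_mul_linear] linear_diff[OF matrix_vector_mul_linear]
  linear_neg[OF matrix_vector_mul_linear] linear_cmul[OF matrix_vector_mul_linear]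

section \<open>The frame along an antiholomorphic symmetry\<close>

text \<open>Here \<open>S\<close> is the matrix acting on light-cone vectors. The symmetry enters
  through \<open>Y_prop\<close> alone, whose factor may vary from point to point with no regularity
  prescribed.\<close>

locale symmetric_gauss_frame =
  fixes D :: "complex set" and Y N :: "complex \<Rightarrow> real ^ (4 + 'n::finite)"
    and F :: "complex \<Rightarrow> real ^ (4 + 'n) ^ (4 + 'n)" and S :: "real ^ (4 + 'n) ^ (4 + 'n)"
    and \<mu> L :: "complex \<Rightarrow> complex"
  assumes D: "open D"
    and Y_smooth: "smooth_map_on D Y"
    and Y_cone: "\<And>z. z \<in> D \<Longrightarrow> Y z \<in> forward_cone (Inl 1)"
    and F_O: "\<And>z. z \<in> D \<Longrightarrow> F z \<in> O_plus (Inl 1)"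
    and col1: "\<And>z. z \<in> D \<Longrightarrow> column (Inl 1) (F z) = (1 / sqrt 2) *\<^sub>R (Y z + N z)"
    and col2: "\<And>z. z \<in> D \<Longrightarrow> column (Inl 2) (F z) = (1 / sqrt 2) *\<^sub>R (- Y z + N z)"
    and col3: "\<And>z. z \<in> D \<Longrightarrow> column (Inl 3) (F z) = frechet_derivative Y (at z) 1"
    and col4: "\<And>z. z \<in> D \<Longrightarrow> column (Inl 4) (F z) = frechet_derivative Y (at z) \<i>"
    and N_gauss: "\<And>z. z \<in> D \<Longrightarrow> N z \<in> gauss_space Y z"
    and S_O: "S \<in> O_plus (Inl 1)"
    and \<mu>D: "\<And>z. z \<in> D \<Longrightarrow> \<mu> z \<in> D"
    and L_hol: "L holomorphic_on D"
    and d\<mu>: "\<And>z. z \<in> D \<Longrightarrow> (\<mu> has_derivative (\<lambda>v. cnj (exp (L z) * v))) (at z)"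
    and Y_prop: "\<And>z. z \<in> D \<Longrightarrow> \<exists>c. Y (\<mu> z) = c *\<^sub>R (S *v Y z)"
begin

abbreviation "DY z \<equiv> frechet_derivative Y (at z)"

lemma F_lor: "z \<in> D \<Longrightarrow> lor (Inl 1) (column i (F z)) (column j (F z)) = minkowski (Inl 1) $ i $ j"
  by (intro lor_column_lorentz O_plus_lorentz F_O)

lemma Y_columns: "z \<in> D \<Longrightarrow> Y z = (1 / sqrt 2) *\<^sub>R (column (Inl 1) (F z) - column (Inl 2) (F z))"
  and N_columns: "z \<in> D \<Longrightarrow> N z = (1 / sqrt 2) *\<^sub>R (column (Inl 1) (F z) + column (Inl 2) (F z))"
  by (simp_all add: col1 col2 algebra_simps flip: scaleR_add_left)

lemma Y_has_derivative: "z \<in> D \<Longrightarrow> (Y has_derivative DY z) (at z)"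
  using smooth_map_on_differentiable(1)[OF Y_smooth] frechet_derivative_works by blast

lemma DY_columns: "z \<in> D \<Longrightarrow> DY z v = Re v *\<^sub>R column (Inl 3) (F z) + Im v *\<^sub>R column (Inl 4) (F z)"
  using has_derivative_partial_sum[OF Y_has_derivative, of z v] by (simp only: col3 col4)

lemma Y_symmetry_derivative:
  assumes "z \<in> D"
  shows "((\<lambda>p. Y (\<mu> p)) has_derivative (\<lambda>v. DY (\<mu> z) (cnj (exp (L z) * v)))) (at z)"
  using has_derivative_compose[OF d\<mu>[OF assms] Y_has_derivative[OF \<mu>D[OF assms]]] .

lemma SY_has_derivative: "z \<in> D \<Longrightarrow> ((\<lambda>p. S *v Y p) has_derivative (\<lambda>v. S *v DY z v)) (at z)"
  by (intro bounded_linear.has_derivative[OF bounded_linear_matrix_vector] Y_has_derivative)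

text \<open>The scaling factor is found by comparing the lengths of the derivatives of both sides.\<close>

lemma Y_symmetry:
  assumes z: "z \<in> D"
  shows "Y (\<mu> z) = exp (Re (L z)) *\<^sub>R (S *v Y z)"
proof -
  \<comment> \<open>Writing the factor as a quotient of positive time components supplies its
    differentiability and its sign.\<close>
  define r where "r = (\<lambda>p. Y (\<mu> p) $ Inl 1 / (S *v Y p) $ Inl 1)"
  have SY: "(S *v Y p) $ Inl 1 > 0" and Y\<mu>: "Y (\<mu> p) $ Inl 1 > 0" if "p \<in> D" for p
    using O_plus_cone[OF S_O Y_cone[OF that]] Y_cone[OF \<mu>D[OF that]]
        by (simp_all add: forward_coneD)
  have r: "Y (\<mu> p) = r p *\<^sub>R (S *v Y p)" "r p > 0" if p: "p \<in> D" for p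
  proof -
    obtain c where c: "Y (\<mu> p) = c *\<^sub>R (S *v Y p)" using Y_prop[OF p] by blast
    then have "r p = c" using SY[OF p] by (simp add: r_def)
    with c show "Y (\<mu> p) = r p *\<^sub>R (S *v Y p)" by simp
    show "r p > 0" using SY[OF p] Y\<mu>[OF p] by (simp add: r_def)
  qed
  have "(\<lambda>p. Y (\<mu> p) $ Inl 1) differentiable (at z)" "(\<lambda>p. (S *v Y p) $ Inl 1) differentiable
      (at z)"
    using bounded_linear.has_derivative[OF bounded_linear_vec_nth Y_symmetry_derivative[OF z]]
      bounded_linear.has_derivative[OF bounded_linear_vec_nth SY_has_derivative[OF z]]
    unfolding differentiable_def by blast+
  then have "r differentiable (at z)" unfolding r_def using SY[OF z]
      by (intro differentiable_divide) auto
  then obtain r' where r': "(r has_derivative r') (at z)" unfolding differentiable_def by blast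
  have "((\<lambda>p. r p *\<^sub>R (S *v Y p)) has_derivative
      (\<lambda>v. r z *\<^sub>R (S *v DY z v) + r' v *\<^sub>R (S *v Y z))) (at z)"
    by (rule has_derivative_scaleR[OF r' SY_has_derivative[OF z]])
  then have "((\<lambda>p. Y (\<mu> p)) has_derivative (\<lambda>v. r z *\<^sub>R (S *v DY z v) + r' v *\<^sub>R (S *v Y z)))
      (at z)"
    by (rule has_derivative_transform_within_open[OF _ D z]) (simp add: r(1)[symmetric])
  from has_derivative_unique[OF this Y_symmetry_derivative[OF z]]
  have "r z *\<^sub>R (S *v DY z 1) + r' 1 *\<^sub>R (S *v Y z) = DY (\<mu> z) (cnj (exp (L z) * 1))"
      by (rule fun_cong)
  then have eq: "DY (\<mu> z) (cnj (exp (L z))) = S *v (r z *\<^sub>R DY z 1 + r' 1 *\<^sub>R Y z)"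
    by (simp add: matrix_vector_linear)
  \<comment> \<open>The last two of the four frame columns are orthonormal. On the other side the
    multiple of \<open>Y\<close> contributes nothing, as \<open>Y\<close> is null and orthogonal to
    its derivatives.\<close>
  have "lor (Inl 1) (DY (\<mu> z) (cnj (exp (L z)))) (DY (\<mu> z) (cnj (exp (L z)))) = (Re (exp (L z)))\<^sup>2
      + (Im (exp (L z)))\<^sup>2"
    unfolding DY_columns[OF \<mu>D[OF z]]
    by (simp add: lor_linear F_lor[OF \<mu>D[OF z]] minkowski_nth power2_eq_square)
  moreover have "lor (Inl 1) (DY (\<mu> z) (cnj (exp (L z)))) (DY (\<mu> z) (cnj (exp (L z)))) = (r z)\<^sup>2"
    unfolding eq lor_matrix_mult[OF O_plus_lorentz[OF S_O]] DY_columns[OF z] Y_columns[OF z]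
    by (simp add: lor_linear F_lor[OF z] minkowski_nth power2_eq_square)
  ultimately have "(r z)\<^sup>2 = (norm (exp (L z)))\<^sup>2" unfolding cmod_power2 by simp
  then have "r z = exp (Re (L z))" using r(2)[OF z] by (simp add: power2_eq_iff_nonneg)
  then show ?thesis using r(1)[OF z] by simp
qed

lemma L_has_derivative: "z \<in> D \<Longrightarrow> (L has_derivative (\<lambda>v. deriv L z * v)) (at z)"
  using holomorphic_derivI[OF L_hol D, of z UNIV] by (simp add: has_field_derivative_def)

lemma scale_has_derivative:
  "z \<in> D \<Longrightarrow> ((\<lambda>p. exp (Re (L p))) has_derivative (\<lambda>v. exp (Re (L z)) * Re (deriv L z * v))) (at z)"
  by (auto intro!: derivative_eq_intros L_has_derivative)

text \<open>The relation \<open>Y_symmetry\<close> differentiated. The additional multiple of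
  \<open>Y\<close> is the logarithmic derivative of the scaling factor and becomes the source of
  \<open>a\<close> and \<open>b\<close>.\<close>

lemma DY_symmetry:
  assumes z: "z \<in> D"
  shows "DY (\<mu> z) (cnj (exp (L z) * v)) = exp (Re (L z)) *\<^sub>R
      (S *v (DY z v + Re (deriv L z * v) *\<^sub>R Y z))"
proof -
  have "((\<lambda>p. exp (Re (L p)) *\<^sub>R (S *v Y p)) has_derivative
      (\<lambda>v. exp (Re (L z)) *\<^sub>R (S *v DY z v)
          + (exp (Re (L z)) * Re (deriv L z * v)) *\<^sub>R (S *v Y z))) (at z)"
    by (rule has_derivative_scaleR[OF scale_has_derivative[OF z] SY_has_derivative[OF z]])
  then have "((\<lambda>p. Y (\<mu> p)) has_derivative
      (\<lambda>v. exp (Re (L z)) *\<^sub>R (S *v DY z v)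
          + (exp (Re (L z)) * Re (deriv L z * v)) *\<^sub>R (S *v Y z))) (at z)"
    by (rule has_derivative_transform_within_open[OF _ D z]) (simp add: Y_symmetry)
  from has_derivative_unique[OF Y_symmetry_derivative[OF z] this]
  have "DY (\<mu> z) (cnj (exp (L z) * v))
      = exp (Re (L z)) *\<^sub>R (S *v DY z v) + (exp (Re (L z)) * Re (deriv L z * v)) *\<^sub>R (S *v Y z)"
          by (rule fun_cong)
  then show ?thesis by (simp add: matrix_vector_linear scaleR_add_right)
qed

lemma gauss_space_eq:
  "z \<in> D \<Longrightarrow> gauss_space Y z = span {Y z, (1/2) *\<^sub>R DY z 1, (- 1/2) *\<^sub>R DY z \<i>, (1/4) *\<^sub>R laplacian
      Y z}"
  by (simp only: gauss_space_def Re_vd_z_cvec Im_vd_z_cvec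
      smooth_map_on_differentiable(1)[OF Y_smooth]
      Re_vd_zbar_vd_z[OF D _ Y_smooth])

lemma normal_orthogonal:
  assumes z: "z \<in> D"
  shows "lor (Inl 1) (Y z) (column (Inr q) (F z)) = 0" "lor (Inl 1) (N z) (column (Inr q) (F z))
      = 0"
    "lor (Inl 1) (DY z v) (column (Inr q) (F z)) = 0"
  by (simp_all add: Y_columns[OF z] N_columns[OF z] DY_columns[OF z] lor_linear F_lor[OF z]
      minkowski_nth)

text \<open>
  The normal \<open>N\<close> has a nonzero component along the Laplacian of \<open>Y\<close> because \<open>Y\<close> is orthogonal to the other
  three generators of the Gauss space but not to \<open>N\<close>.
\<close>

lemma laplacian_orthogonal:
  assumes z: "z \<in> D"
  shows "lor (Inl 1) (laplacian Y z) (column (Inr q) (F z)) = 0"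
proof -
  obtain r s t u where N: "N z = r *\<^sub>R Y z + s *\<^sub>R ((1/2) *\<^sub>R DY z 1) + t *\<^sub>R ((- 1/2) *\<^sub>R DY z \<i>)
      + u *\<^sub>R ((1/4) *\<^sub>R laplacian Y z)"
    using N_gauss[OF z] unfolding gauss_space_eq[OF z] by (rule span_4E)
  have NY: "lor (Inl 1) (N z) (Y z) = - 1" and YY: "lor (Inl 1) (Y z) (Y z) = 0"
    and DYY: "lor (Inl 1) (DY z v) (Y z) = 0" for v
    by (simp_all add: Y_columns[OF z] N_columns[OF z] DY_columns[OF z] lor_linear F_lor[OF z]
        minkowski_nth)
  have "u \<noteq> 0"
  proof
    assume "u = 0"
    then have "lor (Inl 1) (N z) (Y z) = 0" unfolding N by (simp add: lor_linear YY DYY)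
    with NY show False by simp
  qed
  moreover have "lor (Inl 1) (N z) (column (Inr q) (F z))
      = u * (1/4) * lor (Inl 1) (laplacian Y z) (column (Inr q) (F z))"
    unfolding N by (simp add: lor_linear normal_orthogonal[OF z])
  ultimately show ?thesis using normal_orthogonal(2)[OF z, of q] by simp
qed

text \<open>
  Composition with an antiholomorphic map multiplies the Laplacian by the conformal factor, so it suffices
  to compute the Laplacian of the rescaled lift.
\<close>

lemma laplacian_symmetry_orthogonal:
  assumes z: "z \<in> D"
  shows "lor (Inl 1) (laplacian Y (\<mu> z)) (S *v column (Inr q) (F z)) = 0"
proof -
  \<comment> \<open>\<open>\<psi>\<close> is a constant vector, the normal at the single point
    \<open>z\<close>. Hence \<open>h\<close>, \<open>hx\<close>, \<open>hy\<close> and the first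
    derivative of \<open>h\<close> vanish at \<open>z\<close>, and every term with a derivative of
    \<open>c\<close> or of \<open>deriv L\<close> drops out.\<close>
  define \<psi> w where "\<psi> = column (Inr q) (F z)" and "w = S *v \<psi>"
  define h hx hy where "h = (\<lambda>p. lor (Inl 1) (Y p) \<psi>)" and "hx = (\<lambda>p. lor (Inl 1) (DY p 1) \<psi>)"
    and "hy = (\<lambda>p. lor (Inl 1) (DY p \<i>) \<psi>)"
  define gx gy where "gx = (\<lambda>p. lor (Inl 1) (DY p 1) w)" and "gy = (\<lambda>p. lor (Inl 1) (DY p \<i>) w)"
  define u v where "u = (\<lambda>p. Re (exp (L p)))" and "v = (\<lambda>p. Im (exp (L p)))"
  define c where "c = (\<lambda>p. exp (Re (L p)))"
  define X W where "X = (\<lambda>p. frechet_derivative (\<lambda>p. DY p 1) (at p))"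
    and "W = (\<lambda>p. frechet_derivative (\<lambda>p. DY p \<i>) (at p))"
  have lorS: "lor (Inl 1) (S *v x) w = lor (Inl 1) x \<psi>" for x
    unfolding w_def by (rule lor_matrix_mult[OF O_plus_lorentz[OF S_O]])
  have eqs: "u p * gx (\<mu> p) - v p * gy (\<mu> p) = c p * (hx p + Re (deriv L p) * h p)"
    "- (v p * gx (\<mu> p)) - u p * gy (\<mu> p) = c p * (hy p - Im (deriv L p) * h p)" if p: "p \<in> D" for p
  proof -
    have *: "lor (Inl 1) (DY (\<mu> p) (cnj (exp (L p) * t))) w
        = c p * (lor (Inl 1) (DY p t) \<psi> + Re (deriv L p * t) * h p)" for t
      unfolding DY_symmetry[OF p] c_def by (simp add: lor_linear lorS h_def)
    have **: "lor (Inl 1) (DY (\<mu> p) s) w = Re s * gx (\<mu> p) + Im s * gy (\<mu> p)" for s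
      using has_derivative_partial_sum[OF Y_has_derivative[OF \<mu>D[OF p]], of s]
          by (simp add: lor_linear gx_def gy_def)
    show "u p * gx (\<mu> p) - v p * gy (\<mu> p) = c p * (hx p + Re (deriv L p) * h p)"
      using *[of 1] unfolding ** by (simp add: u_def v_def hx_def)
    show "- (v p * gx (\<mu> p)) - u p * gy (\<mu> p) = c p * (hy p - Im (deriv L p) * h p)"
      using *[of \<i>] unfolding ** by (simp add: u_def v_def hy_def)
  qed
  have dX: "((\<lambda>p. DY p 1) has_derivative X p) (at p)"
      and dW: "((\<lambda>p. DY p \<i>) has_derivative W p) (at p)" if "p \<in> D" for p
    using smooth_map_on_differentiable(2)[OF Y_smooth that] frechet_derivative_works
        unfolding X_def W_def by blast+
  note lor_d = bounded_linear.has_derivative[OF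
      bounded_bilinear.bounded_linear_left[OF bounded_bilinear_lor]]
  have dh: "(h has_derivative (\<lambda>t. lor (Inl 1) (DY z t) \<psi>)) (at z)"
    unfolding h_def by (rule lor_d[OF Y_has_derivative[OF z]])
  have dhx: "(hx has_derivative (\<lambda>t. lor (Inl 1) (X z t) \<psi>)) (at z)"
    and dhy: "(hy has_derivative (\<lambda>t. lor (Inl 1) (W z t) \<psi>)) (at z)"
    unfolding hx_def hy_def by (rule lor_d[OF dX[OF z]], rule lor_d[OF dW[OF z]])
  have dgx: "((\<lambda>p. gx (\<mu> p)) has_derivative (\<lambda>t. lor (Inl 1) (X (\<mu> z) (cnj (exp (L z) * t))) w))
      (at z)"
    unfolding gx_def by (rule lor_d[OF has_derivative_compose[OF d\<mu>[OF z] dX[OF \<mu>D[OF z]]]])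
  have dgy: "((\<lambda>p. gy (\<mu> p)) has_derivative (\<lambda>t. lor (Inl 1) (W (\<mu> z) (cnj (exp (L z) * t))) w))
      (at z)"
    unfolding gy_def by (rule lor_d[OF has_derivative_compose[OF d\<mu>[OF z] dW[OF \<mu>D[OF z]]]])
  define \<epsilon> where "\<epsilon> = exp (L z) * deriv L z"
  have dexp: "((\<lambda>p. exp (L p)) has_derivative (\<lambda>t. \<epsilon> * t)) (at z)"
    unfolding \<epsilon>_def by (auto intro!: derivative_eq_intros L_has_derivative z simp: mult_ac)
  have du: "(u has_derivative (\<lambda>t. Re (\<epsilon> * t))) (at z)"
      and dv: "(v has_derivative (\<lambda>t. Im (\<epsilon> * t))) (at z)"
    unfolding u_def v_def
    by (rule bounded_linear.has_derivative[OF bounded_linear_Re dexp], rule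
        bounded_linear.has_derivative[OF bounded_linear_Im dexp])
  have dc: "(c has_derivative (\<lambda>t. c z * Re (deriv L z * t))) (at z)"
    unfolding c_def by (rule scale_has_derivative[OF z])
  define L2 where "L2 = deriv (deriv L) z"
  have dL: "(deriv L has_derivative (\<lambda>t. L2 * t)) (at z)"
    using holomorphic_derivI[OF holomorphic_deriv[OF L_hol D] D z, of UNIV]
        by (simp add: has_field_derivative_def L2_def)
  have zero: "h z = 0" "hx z = 0" "hy z = 0" "lor (Inl 1) (DY z t) \<psi> = 0" for t
    using normal_orthogonal[OF z] by (simp_all add: h_def hx_def hy_def \<psi>_def)
  have "((\<lambda>p. c p * (hx p + Re (deriv L p) * h p))
      has_derivative (\<lambda>t. c z * lor (Inl 1) (X z t) \<psi>)) (at z)"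
    by (rule has_derivative_eq_rhs, rule has_derivative_mult[OF dc has_derivative_add[OF dhx
          has_derivative_mult[OF bounded_linear.has_derivative[OF bounded_linear_Re dL] dh]]])
       (simp add: zero fun_eq_iff)
  then have "((\<lambda>p. u p * gx (\<mu> p) - v p * gy (\<mu> p))
      has_derivative (\<lambda>t. c z * lor (Inl 1) (X z t) \<psi>)) (at z)"
    by (rule has_derivative_transform_within_open[OF _ D z]) (simp add: eqs)
  from fun_cong[OF has_derivative_unique[OF
      has_derivative_diff[OF has_derivative_mult[OF du dgx] has_derivative_mult[OF dv dgy]] this],
      of 1]
  have e1: "u z * lor (Inl 1) (X (\<mu> z) (cnj (exp (L z)))) w + Re \<epsilon> * gx (\<mu> z)
      - (v z * lor (Inl 1) (W (\<mu> z) (cnj (exp (L z)))) w + Im \<epsilon> * gy (\<mu> z))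
          = c z * lor (Inl 1) (X z 1) \<psi>"
    by simp
  have "((\<lambda>p. c p * (hy p - Im (deriv L p) * h p))
      has_derivative (\<lambda>t. c z * lor (Inl 1) (W z t) \<psi>)) (at z)"
    by (rule has_derivative_eq_rhs, rule has_derivative_mult[OF dc has_derivative_diff[OF dhy
          has_derivative_mult[OF bounded_linear.has_derivative[OF bounded_linear_Im dL] dh]]])
       (simp add: zero fun_eq_iff)
  then have "((\<lambda>p. - (v p * gx (\<mu> p)) - u p * gy (\<mu> p))
      has_derivative (\<lambda>t. c z * lor (Inl 1) (W z t) \<psi>)) (at z)"
    by (rule has_derivative_transform_within_open[OF _ D z]) (simp add: eqs)
  from fun_cong[OF has_derivative_unique[OF
      has_derivative_diff[OF has_derivative_minus[OF has_derivative_mult[OF dv dgx]]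
      has_derivative_mult[OF du dgy]] this], of \<i>]
  have e2: "- (v z * lor (Inl 1) (X (\<mu> z) (cnj (exp (L z) * \<i>))) w + Re \<epsilon> * gx (\<mu> z))
      - (u z * lor (Inl 1) (W (\<mu> z) (cnj (exp (L z) * \<i>))) w - Im \<epsilon> * gy (\<mu> z))
          = c z * lor (Inl 1) (W z \<i>) \<psi>"
    by simp
  have X: "lor (Inl 1) (X (\<mu> z) s) w = Re s * lor (Inl 1) (X (\<mu> z) 1) w
      + Im s * lor (Inl 1) (X (\<mu> z) \<i>) w"
    and W: "lor (Inl 1) (W (\<mu> z) s) w = Re s * lor (Inl 1) (W (\<mu> z) 1) w
        + Im s * lor (Inl 1) (W (\<mu> z) \<i>) w" for s
    using has_derivative_partial_sum[OF dX[OF \<mu>D[OF z]], of s]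
        has_derivative_partial_sum[OF dW[OF \<mu>D[OF z]], of s]
    by (simp_all add: lor_linear)
  have lap: "lor (Inl 1) (X z 1) \<psi> + lor (Inl 1) (W z \<i>) \<psi> = 0"
    using laplacian_orthogonal[OF z, of q] by (simp add: laplacian_def X_def W_def \<psi>_def lor_linear)
  have s1: "Re (cnj (exp (L z))) = u z" "Im (cnj (exp (L z))) = - v z"
    and s2: "Re (cnj (exp (L z) * \<i>)) = - v z" "Im (cnj (exp (L z) * \<i>)) = - u z"
    by (simp_all add: u_def v_def)
  \<comment> \<open>In the sum of \<open>e1\<close> and \<open>e2\<close> the terms with
    \<open>\<epsilon>\<close> cancel by the Cauchy-Riemann equations. The cross terms with
    \<open>u z * v z\<close> cancel separately for \<open>X\<close> and for \<open>W\<close>, so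
    mixed second derivatives never have to be compared.\<close>
  have "((u z)\<^sup>2 + (v z)\<^sup>2) * (lor (Inl 1) (X (\<mu> z) 1) w + lor (Inl 1) (W (\<mu> z) \<i>) w)
      = c z * (lor (Inl 1) (X z 1) \<psi> + lor (Inl 1) (W z \<i>) \<psi>)"
    unfolding distrib_left[of "c z"] e1[symmetric] e2[symmetric]
      X[of "cnj (exp (L z))"] X[of "cnj (exp (L z) * \<i>)"] W[of "cnj (exp (L z))"]
          W[of "cnj (exp (L z) * \<i>)"] s1 s2
    by (simp add: algebra_simps power2_eq_square)
  moreover have "(u z)\<^sup>2 + (v z)\<^sup>2 \<noteq> 0"
    unfolding u_def v_def cmod_power2[symmetric] by simp
  ultimately have "lor (Inl 1) (X (\<mu> z) 1) w + lor (Inl 1) (W (\<mu> z) \<i>) w = 0" unfolding lap by auto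
  then show ?thesis by (simp add: laplacian_def X_def W_def w_def \<psi>_def lor_linear)
qed

section \<open>The transition matrix from the transported frame at \<open>z\<close> to the frame at
  \<open>\<mu> z\<close>\<close>

definition transition :: "complex \<Rightarrow> real ^ (4 + 'n) ^ (4 + 'n)" where
  "transition z = lorentz_inv (Inl 1) (S ** F z) ** F (\<mu> z)"

lemma SF_lorentz: "z \<in> D \<Longrightarrow> lorentz_matrix (Inl 1) (S ** F z)"
  by (intro lorentz_matrix_mult O_plus_lorentz S_O F_O)

lemma frame_symmetry: "z \<in> D \<Longrightarrow> F (\<mu> z) = S ** F z ** transition z"
  by (simp add: transition_def lorentz_matrix_cancel[OF SF_lorentz])

lemma transition_O_plus: "z \<in> D \<Longrightarrow> transition z \<in> O_plus (Inl 1)"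
  unfolding transition_def by (intro O_plus_mult O_plus_inv S_O F_O \<mu>D)

text \<open>The entries are Lorentz products of a transported normal \<open>w\<close> with the first
  four frame columns at \<open>\<mu> z\<close>. These columns lie in the Gauss space there, and
  \<open>w\<close> is orthogonal to each of its generators.\<close>

lemma transition_lower_left:
  assumes z: "z \<in> D"
  shows "transition z $ Inr q $ Inl j = 0"
proof -
  define w where "w = S *v column (Inr q) (F z)"
  have lorS: "lor (Inl 1) (S *v x) w = lor (Inl 1) x (column (Inr q) (F z))" for x
    unfolding w_def by (rule lor_matrix_mult[OF O_plus_lorentz[OF S_O]])
  have Y0: "lor (Inl 1) (Y (\<mu> z)) w = 0"
    by (simp add: Y_symmetry[OF z] lor_linear lorS normal_orthogonal[OF z])
  have DY0: "lor (Inl 1) (DY (\<mu> z) s) w = 0" for s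
  proof -
    \<comment> \<open>The differential of \<open>\<mu>\<close> is bijective, so
      \<open>DY_symmetry\<close> reaches every direction at the image point.\<close>
    have "s = cnj (exp (L z) * (cnj s / exp (L z)))" by simp
    then have "DY (\<mu> z) s = DY (\<mu> z) (cnj (exp (L z) * (cnj s / exp (L z))))" by (rule arg_cong)
    then show ?thesis unfolding DY_symmetry[OF z]
        by (simp add: lor_linear lorS normal_orthogonal[OF z])
  qed
  have "subspace {x. lor (Inl 1) x w = 0}" by (auto simp: subspace_def lor_linear)
  moreover have "lor (Inl 1) (laplacian Y (\<mu> z)) w = 0"
    unfolding w_def by (rule laplacian_symmetry_orthogonal[OF z])
  ultimately have "gauss_space Y (\<mu> z) \<subseteq> {x. lor (Inl 1) x w = 0}"
    unfolding gauss_space_eq[OF \<mu>D[OF z]]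
    by (intro span_minimal)
       (auto simp: lor_linear Y0 DY0)
  then have N0: "lor (Inl 1) (N (\<mu> z)) w = 0" using N_gauss[OF \<mu>D[OF z]] by blast
  have "\<forall>j::4. lor (Inl 1) (column (Inl j) (F (\<mu> z))) w = 0"
    unfolding forall_4
    by (simp add: col1[OF \<mu>D[OF z]] col2[OF \<mu>D[OF z]] col3[OF \<mu>D[OF z]] col4[OF \<mu>D[OF z]]
        lor_linear Y0 DY0 N0)
  then show ?thesis
    by (simp add: transition_def lorentz_inv_nth column_matrix_mult w_def[symmetric]
        lor_commute[of _ w])
qed

lemma transition_block:
  assumes z: "z \<in> D"
  shows "transition z = blockdiag (upper_left (transition z)) (lower_right (transition z))"
    and "lorentz_matrix 1 (upper_left (transition z))"
        and "orthogonal_matrix (lower_right (transition z))"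
  by (intro lorentz_block_triangular[OF O_plus_lorentz[OF transition_O_plus[OF z]]
      transition_lower_left[OF z]])+

lemma column_transition:
  assumes "z \<in> D" "column j (F (\<mu> z)) = S *v (F z *v x)"
  shows "column j (transition z) = x"
  unfolding transition_def column_matrix_mult assms(2)
  using lorentz_matrix_cancel(3)[OF SF_lorentz[OF assms(1)], of x]
      by (simp add: matrix_vector_mul_assoc)

text \<open>Each column lists the coordinates of a frame vector at \<open>\<mu> z\<close> in the
  frame \<open>S ** F z\<close>. The lift itself yields the difference of the first two columns, its
  derivatives yield columns 3 and 4.\<close>

lemma upper_left_transition:
  assumes z: "z \<in> D" and e: "cnj (exp (L z)) = exp (complex_of_real \<tau> + \<i> * complex_of_real \<theta>)"
    and a: "a = - Re (deriv L z) / sqrt 2" and b: "b = Im (deriv L z) / sqrt 2"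
  shows "upper_left (transition z) = k1_matrix \<tau> \<theta> a b"
proof (rule lorentz_null_fixing_eq_k1_matrix)
  have eL: "exp (L z) = exp (complex_of_real \<tau> - \<i> * complex_of_real \<theta>)"
    using arg_cong[OF e, of cnj] by (simp add: exp_cnj)
  have "exp (Re (L z)) = norm (exp (complex_of_real \<tau> - \<i> * complex_of_real \<theta>))"
    using eL by (metis norm_exp_eq_Re)
  then have c: "exp (Re (L z)) = exp \<tau>" by simp
  have nth4: "column j (upper_left (transition z)) $ i = column (Inl j) (transition z) $ Inl i"
      for i j :: 4
    by (simp add: upper_left_def column_def)
  have axis4: "axis (Inl p) 1 $ Inl i = (axis p 1 $ i :: real)" for p i :: 4 by (simp add: axis_def)
  show "lorentz_matrix 1 (upper_left (transition z))" by (rule transition_block(2)[OF z])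
  note F_axis = matrix_vector_mult_basis[of "F z"]
  have "column (Inl 1) (F (\<mu> z)) - column (Inl 2) (F (\<mu> z)) = sqrt 2 *\<^sub>R Y (\<mu> z)"
    by (simp add: Y_columns[OF \<mu>D[OF z]])
  also have "\<dots> = S *v (F z *v (exp \<tau> *\<^sub>R (axis (Inl 1) 1 - axis (Inl 2) 1)))"
    unfolding Y_symmetry[OF z] Y_columns[OF z] by (simp add: matrix_vector_linear F_axis c)
  finally have "S ** F z *v (column (Inl 1) (transition z) - column (Inl 2) (transition z))
      = S ** F z *v (exp \<tau> *\<^sub>R (axis (Inl 1) 1 - axis (Inl 2) 1))"
    by (simp add: frame_symmetry[OF z] column_matrix_mult matrix_vector_linear
        matrix_vector_mul_assoc)
  then have "column (Inl 1) (transition z) - column (Inl 2) (transition z)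
      = exp \<tau> *\<^sub>R (axis (Inl 1) 1 - axis (Inl 2) 1)"
    using lorentz_matrix_cancel(3)[OF SF_lorentz[OF z]] by metis
  then show "column 1 (upper_left (transition z)) - column 2 (upper_left (transition z))
      = exp \<tau> *\<^sub>R (axis 1 1 - axis 2 1)"
    by (simp add: vec_eq_iff nth4) (metis axis4 vector_minus_component)
  have YF: "Y z = F z *v ((1 / sqrt 2) *\<^sub>R (axis (Inl 1) 1 - axis (Inl 2) 1))"
    by (simp add: Y_columns[OF z] matrix_vector_linear F_axis)
  have DYF: "DY z s = F z *v (Re s *\<^sub>R axis (Inl 3) 1 + Im s *\<^sub>R axis (Inl 4) 1)" for s
    by (simp add: DY_columns[OF z] matrix_vector_linear F_axis)
  have general: "DY (\<mu> z) (cnj s) = S *v (F z *v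
      (Re (cis \<theta> * s) *\<^sub>R axis (Inl 3) 1 + Im (cis \<theta> * s) *\<^sub>R axis (Inl 4) 1
       + (Re (deriv L z * (cis \<theta> * s)) / sqrt 2) *\<^sub>R (axis (Inl 1) 1 - axis (Inl 2) 1)))" for s
  proof -
    \<comment> \<open>\<open>t\<close> is the preimage of \<open>cnj s\<close> under the
      differential of \<open>\<mu>\<close>, because \<open>exp (L z)\<close> has modulus
      \<open>exp \<tau>\<close> and argument \<open>- \<theta>\<close>.\<close>
    define t where "t = exp (- complex_of_real \<tau>) * cis \<theta> * s"
    have et: "exp (L z) * t = s"
      unfolding eL t_def by (simp add: exp_diff exp_minus cis_conv_exp field_simps)
    have ct: "complex_of_real (exp \<tau>) * t = cis \<theta> * s"
      unfolding t_def by (simp add: exp_minus field_simps flip: exp_of_real)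
    have "linear (DY z)" using Y_has_derivative[OF z] by (rule has_derivative_linear)
    then have 1: "exp \<tau> *\<^sub>R DY z t = DY z (cis \<theta> * s)"
      unfolding ct[symmetric] by (simp add: linear_cmul scaleR_conv_of_real[symmetric])
    have 2: "exp \<tau> * Re (deriv L z * t) = Re (deriv L z * (cis \<theta> * s))"
      unfolding ct[symmetric] by (simp add: algebra_simps)
    have "DY (\<mu> z) (cnj s) = S *v (exp \<tau> *\<^sub>R DY z t + (exp \<tau> * Re (deriv L z * t)) *\<^sub>R Y z)"
      using DY_symmetry[OF z, of t] unfolding et c
          by (simp add: matrix_vector_linear scaleR_add_right)
    also have "exp \<tau> *\<^sub>R DY z t + (exp \<tau> * Re (deriv L z * t)) *\<^sub>R Y z = F z *v
      (Re (cis \<theta> * s) *\<^sub>R axis (Inl 3) 1 + Im (cis \<theta> * s) *\<^sub>R axis (Inl 4) 1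
       + (Re (deriv L z * (cis \<theta> * s)) / sqrt 2) *\<^sub>R (axis (Inl 1) 1 - axis (Inl 2) 1))"
      unfolding 1 2 unfolding YF DYF by (simp add: matrix_vector_linear)
    finally show ?thesis .
  qed
  have c3: "column (Inl 3) (transition z) = cos \<theta> *\<^sub>R axis (Inl 3) 1 + sin \<theta> *\<^sub>R axis (Inl 4) 1
       + (- a * cos \<theta> - b * sin \<theta>) *\<^sub>R (axis (Inl 1) 1 - axis (Inl 2) 1)"
    by (rule column_transition[OF z]) (use general[of 1]
        in \<open>simp add: col3[OF \<mu>D[OF z]] a b diff_divide_distrib\<close>)
  then show "column 3 (upper_left (transition z))
      = (- a * cos \<theta> - b * sin \<theta>) *\<^sub>R (axis 1 1 - axis 2 1)
               + cos \<theta> *\<^sub>R axis 3 1 + sin \<theta> *\<^sub>R axis 4 1"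
    by (simp add: vec_eq_iff nth4 axis4)
  \<comment> \<open>The direction \<open>\<i>\<close> at the image point is the conjugate of
    \<open>- \<i>\<close>, hence this choice of \<open>s\<close>; the conjugation makes the
    trigonometric block a reflection.\<close>
  have c4: "column (Inl 4) (transition z) = sin \<theta> *\<^sub>R axis (Inl 3) 1 + (- cos \<theta>) *\<^sub>R axis (Inl 4) 1
       + (- a * sin \<theta> + b * cos \<theta>) *\<^sub>R (axis (Inl 1) 1 - axis (Inl 2) 1)"
    by (rule column_transition[OF z]) (use general[of "- \<i>"]
        in \<open>simp add: col4[OF \<mu>D[OF z]] a b add_divide_distrib add.commute\<close>)
  then show "column 4 (upper_left (transition z))
      = (- a * sin \<theta> + b * cos \<theta>) *\<^sub>R (axis 1 1 - axis 2 1)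
               + sin \<theta> *\<^sub>R axis 3 1 - cos \<theta> *\<^sub>R axis 4 1"
    by (simp add: vec_eq_iff nth4 axis4)
qed

end

section \<open>Orientation, lifts and the proof of the theorem\<close>

lemma oriented_span_negative:
  fixes B :: "('n::finite) basis4"
  assumes "det K < 0"
  shows "oriented_span (M ** B ** K) = act_oriented M (reverse_orientation (oriented_span B))"
proof (intro set_eqI iffI)
  fix C assume "C \<in> oriented_span (M ** B ** K)"
  then obtain A where A: "C = M ** B ** K ** A" "det A > 0" by (auto simp: oriented_span_def)
  have "B ** mat 1 \<in> oriented_span B"
    unfolding oriented_span_def by (intro CollectI exI[of _ "mat 1"]) simp
  moreover have "det (K ** A) < 0" using A(2) assms by (simp add: det_mul mult_neg_pos)
  ultimately have "B ** (K ** A) \<in> reverse_orientation (oriented_span B)"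
    unfolding reverse_orientation_def by auto
  then show "C \<in> act_oriented M (reverse_orientation (oriented_span B))"
    unfolding act_oriented_def A(1) by (simp add: matrix_mul_assoc[symmetric])
next
  fix C assume "C \<in> act_oriented M (reverse_orientation (oriented_span B))"
  then obtain A A' where A: "C = M ** (B ** A ** A')" "det A > 0" "det A' < 0"
    by (auto simp: act_oriented_def reverse_orientation_def oriented_span_def)
  obtain K' where K': "K ** K' = mat 1"
    using assms invertible_det_nz[of K] by (auto simp: invertible_def)
  then have "det K * det K' = 1" by (metis det_I det_mul)
  then have "det K' < 0" using assms mult_nonpos_nonneg[of "det K" "det K'"] by linarith
  \<comment> \<open>Both \<open>A'\<close> and the inverse \<open>K'\<close> of \<open>K\<close>
    reverse orientation, so the combined change of basis is positive.\<close>
  then have "det (K' ** A ** A') > 0" using A(2,3) by (simp add: det_mul mult_neg_pos mult_neg_neg)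
  moreover have "C = M ** B ** K ** (K' ** A ** A')"
  proof -
    have "M ** B ** K ** (K' ** A ** A') = M ** B ** (K ** K') ** A ** A'"
        by (simp add: matrix_mul_assoc)
    then show ?thesis by (simp add: K' A(1) matrix_mul_assoc)
  qed
  ultimately show "C \<in> oriented_span (M ** B ** K)" unfolding oriented_span_def by blast
qed

lemma first_four_mult: "first_four (A ** B) = A ** first_four B"
  by (simp add: first_four_def matrix_matrix_mult_def vec_eq_iff)

lemma first_four_blockdiag: "first_four (A ** blockdiag K K') = first_four A ** K"
  by (simp add: first_four_def matrix_matrix_mult_def vec_eq_iff sum_UNIV_plus)

lemma column_first_four: "column j (first_four A) = column (Inl j) A"
  by (simp add: first_four_def column_def)

lemma vd_z_columns:
  assumes "Y differentiable (at z)" "vd_z (\<lambda>p. cvec (Y p)) z = (1/2) *s (cvec a - \<i> *s cvec b)"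
  shows "a = frechet_derivative Y (at z) 1" "b = frechet_derivative Y (at z) \<i>"
proof -
  have "(complex_of_real (frechet_derivative Y (at z) 1 $ i) - \<i> * complex_of_real
      (frechet_derivative Y (at z) \<i> $ i)) / 2
      = (1/2) * (complex_of_real (a $ i) - \<i> * complex_of_real (b $ i))" for i
    using vd_z_cvec[OF assms(1), of i] assms(2) by (simp add: cvec_def)
  then have "frechet_derivative Y (at z) 1 $ i = a $ i \<and> frechet_derivative Y (at z) \<i> $ i
      = b $ i" for i
    by (simp add: complex_eq_iff)
  then show "a = frechet_derivative Y (at z) 1" "b = frechet_derivative Y (at z) \<i>"
    by (simp_all add: vec_eq_iff)
qed

text \<open>Both vectors represent the point \<open>S (y z)\<close> of the sphere. The sign of
  \<open>c\<close> is left open here; in \<open>Y_symmetry\<close> the forward cone settles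
  it.\<close>

lemma lift_symmetry_proportional:
  assumes lift: "canonical_lift D y Y" and "induces A S" and "reversing_symmetry D y \<mu> S"
    and "z \<in> D" "\<mu> z \<in> D" "y z \<in> sphere 0 1"
  shows "\<exists>c. Y (\<mu> z) = c *\<^sub>R (A *v Y z)"
proof -
  have "proj_eq (Y z) (cone_point (y z))" "proj_eq (Y (\<mu> z)) (cone_point (S (y z)))"
    "proj_eq (A *v cone_point (y z)) (cone_point (S (y z)))"
    using assms by (auto simp: canonical_lift_def induces_def reversing_symmetry_def)
  then obtain p q r where p: "p \<noteq> 0" "Y z = p *\<^sub>R cone_point (y z)"
    and q: "Y (\<mu> z) = q *\<^sub>R cone_point (S (y z))"
    and r: "r \<noteq> 0" "A *v cone_point (y z) = r *\<^sub>R cone_point (S (y z))"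
    unfolding proj_eq_def by blast
  have "A *v Y z = (p * r) *\<^sub>R cone_point (S (y z))"
    unfolding p(2) by (simp add: matrix_vector_linear r(2))
  then have "Y (\<mu> z) = (q / (p * r)) *\<^sub>R (A *v Y z)" using p(1) r(1) by (simp add: q)
  then show ?thesis by blast
qed

text \<open>\<open>Re L\<close> is half the sum of \<open>L\<close> and its conjugate, and the
  conjugate has vanishing \<open>z\<close>-derivative.\<close>

lemma d_z_Re_holomorphic:
  assumes "open D" "z \<in> D" and L: "(L has_derivative (\<lambda>v. L' * v)) (at z)" and \<tau>: "\<And>p. p \<in> D \<Longrightarrow> \<tau> p
      = Re (L p)"
  shows "d_z (\<lambda>p. complex_of_real (\<tau> p)) z = L' / 2"
proof -
  have "((\<lambda>p. complex_of_real (Re (L p))) has_derivative (\<lambda>v. complex_of_real (Re (L' * v))))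
      (at z)"
    by (intro has_derivative_of_real bounded_linear.has_derivative[OF bounded_linear_Re] L)
  then have "((\<lambda>p. complex_of_real (\<tau> p)) has_derivative (\<lambda>v. complex_of_real (Re (L' * v))))
      (at z)"
    by (rule has_derivative_transform_within_open[OF _ assms(1,2)]) (simp add: \<tau>)
  from frechet_derivative_at[OF this, symmetric]
  show ?thesis by (simp add: d_z_def partial_x_def partial_y_def complex_eq_iff)
qed

theorem theorem3p1:
  fixes D :: "complex set" and z0 :: complex
    and y :: "complex \<Rightarrow> real ^ (3 + 'n::finite)"
    and f :: "complex \<Rightarrow> 'n basis4 set"
    and \<mu> :: "complex \<Rightarrow> complex"
    and S :: "real ^ (3 + 'n) \<Rightarrow> real ^ (3 + 'n)"
    and S_hat :: "real ^ (4 + 'n) ^ (4 + 'n)"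
    and F :: "complex \<Rightarrow> real ^ (4 + 'n) ^ (4 + 'n)"
    and Fx :: "complex \<Rightarrow> complex \<Rightarrow> real ^ (4 + 'n) ^ (4 + 'n)"
  assumes "D = ball 0 1 \<or> D = UNIV" and "z0 \<in> D"
    and "willmore_surface D y"
    and "conformal_gauss_map D y f" and "harmonic_map D f"
    and "reversing_symmetry D y \<mu> S"
    and "S_hat \<in> O_plus (Inl 1)" and "induces S_hat S"
    and "gauss_frame D y F"
    and "extended_frame D z0 F Fx"
  shows "\<exists>M k1 k2.
    M \<in> twisted_loops \<and>
    (\<forall>z\<in>D. k1 z \<in> O_plus (1::4) \<and> orthogonal_matrix (k2 z) \<and>
           det (k1 z) = - 1 \<and> det (k2 z) = - det S_hat) \<and>
    (\<forall>z\<in>D. \<forall>lam\<in>sphere 0 1.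
       Fx (\<mu> z) lam = M lam ** Fx z (inverse lam) ** blockdiag (k1 z) (k2 z)) \<and>
    S_hat = M 1 \<and>
    (\<forall>\<tau> \<theta> :: complex \<Rightarrow> real.
       (\<forall>z\<in>D. d_zbar \<mu> z = exp (complex_of_real (\<tau> z) + \<i> * complex_of_real (\<theta> z))) \<longrightarrow>
       (\<forall>z\<in>D. k1 z = k1_matrix (\<tau> z) (\<theta> z)
          (- Re (complex_of_real (sqrt 2) * d_z (\<lambda>p. complex_of_real (\<tau> p)) z))
          (Im (complex_of_real (sqrt 2) * d_z (\<lambda>p. complex_of_real (\<tau> p)) z)))) \<and>
    (\<forall>z\<in>D. \<forall>lam\<in>sphere 0 1.
       mod_K (Fx (\<mu> z) lam) =
       act_oriented (M lam) (reverse_orientation (mod_K (Fx z (inverse lam)))))"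
proof -
  have D: "open D" "convex D" using assms(1) by auto
  have y: "y z \<in> sphere 0 1" if "z \<in> D" for z
    using assms(3) that unfolding willmore_surface_def conformal_immersion_def by blast
  have bij: "bij_betw \<mu> D D" and hol: "(\<lambda>z. cnj (\<mu> z)) holomorphic_on D"
    using assms(6) by (auto simp: reversing_symmetry_def)
  have \<mu>D: "\<mu> z \<in> D" if "z \<in> D" for z using bij that by (auto simp: bij_betw_def)
  have F_smooth: "smooth_map_on D F" and F_SO: "F z \<in> SO_plus (Inl 1)" if "z \<in> D" for z
    using assms(9) that by (auto simp: gauss_frame_def)
  have F_O: "F z \<in> O_plus (Inl 1)" and F_det: "det (F z) = 1" if "z \<in> D" for z
    using F_SO[OF that] by (auto simp: SO_plus_def)
  obtain Y N where lift: "canonical_lift D y Y" and N_gauss: "\<And>z. z \<in> D \<Longrightarrow> N z \<in> gauss_space Y z"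
    and c1: "\<And>z. z \<in> D \<Longrightarrow> column (Inl 1) (F z) = (1 / sqrt 2) *\<^sub>R (Y z + N z)"
    and c2: "\<And>z. z \<in> D \<Longrightarrow> column (Inl 2) (F z) = (1 / sqrt 2) *\<^sub>R (- Y z + N z)"
    and Yz: "\<And>z. z \<in> D \<Longrightarrow> vd_z (\<lambda>p. cvec (Y p)) z =
            (1/2) *s (cvec (column (Inl 3) (F z)) - \<i> *s cvec (column (Inl 4) (F z)))"
    using assms(9) unfolding gauss_frame_def gauss_basis_def column_first_four by blast
  have Y_smooth: "smooth_map_on D Y" and Y_cone: "Y z \<in> forward_cone (Inl 1)" if "z \<in> D" for z
    using lift that by (auto simp: canonical_lift_def)
  obtain L where L: "L holomorphic_on D"
    and d\<mu>: "\<And>z. z \<in> D \<Longrightarrow> (\<mu> has_derivative (\<lambda>v. cnj (exp (L z) * v))) (at z)"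
    using antiholomorphic_log_derivative[OF D bij hol] by blast
  interpret sym: symmetric_gauss_frame D Y N F S_hat \<mu> L
  proof
    fix z assume z: "z \<in> D"
    note c34 = vd_z_columns[OF smooth_map_on_differentiable(1)[OF Y_smooth[OF z] z] Yz[OF z]]
    show "column (Inl 3) (F z) = frechet_derivative Y (at z) 1" "column (Inl 4) (F z)
        = frechet_derivative Y (at z) \<i>"
      by (fact c34)+
    show "\<exists>c. Y (\<mu> z) = c *\<^sub>R (S_hat *v Y z)"
      by (rule lift_symmetry_proportional[OF lift assms(8,6) z \<mu>D[OF z] y[OF z]])
  qed (use D L assms(2,7) in \<open>blast intro: Y_smooth Y_cone F_O c1 c2 N_gauss \<mu>D d\<mu>\<close>)+
  interpret ext: lorentz_extended_frame D z0 F Fx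
  proof
    show "F differentiable (at z)" if "z \<in> D" for z
      using smooth_map_on_differentiable(1)[OF F_smooth[OF that] that] .
    show "continuous_on D (\<lambda>z. frechet_derivative F (at z) v)" for v
      using smooth_map_on_C1[OF F_smooth[OF assms(2)]] .
  qed (use D assms(2,10) in \<open>auto intro: O_plus_lorentz F_O\<close>)
  define k where "k = sym.transition"
  define k1 k2 where "k1 = (\<lambda>z. upper_left (k z))" and "k2 = (\<lambda>z. lower_right (k z))"
  \<comment> \<open>Forced by the desired relation at \<open>z0\<close>, where the extended frame is
    the identity for every parameter.\<close>
  define M where "M = (\<lambda>lam. Fx (\<mu> z0) lam ** lorentz_inv (Inl 1) (k z0))"
  have k_block: "k z = blockdiag (k1 z) (k2 z)" if "z \<in> D" for z
    unfolding k_def k1_def k2_def by (rule sym.transition_block(1)[OF that])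
  have k_O: "k z \<in> O_plus (Inl 1)" if "z \<in> D" for z
    unfolding k_def by (rule sym.transition_O_plus[OF that])
  have k_sigma: "sigma (k z) = k z" if "z \<in> D" for z
    unfolding k_block[OF that] by (rule sigma_blockdiag)
  have frame: "F (\<mu> z) = S_hat ** F z ** k z" if "z \<in> D" for z
    unfolding k_def by (rule sym.frame_symmetry[OF that])
  have k1_eq: "k1 z = k1_matrix \<tau> \<theta> (- Re (deriv L z) / sqrt 2) (Im (deriv L z) / sqrt 2)"
    if "z \<in> D" "cnj (exp (L z)) = exp (complex_of_real \<tau> + \<i> * complex_of_real \<theta>)" for z \<tau> \<theta>
    unfolding k1_def k_def by (rule sym.upper_left_transition[OF that refl refl])
  have k1_det: "det (k1 z) = - 1" if z: "z \<in> D" for z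
  proof -
    \<comment> \<open>The determinant of \<open>k1_matrix\<close> is the same for all parameters, so
      any logarithm serves; the conjugate of \<open>L\<close> is at hand.\<close>
    have "cnj (exp (L z)) = exp (complex_of_real (Re (L z)) + \<i> * complex_of_real (- Im (L z)))"
      by (simp add: exp_cnj complex_eq_iff flip: complex_eq)
         (simp add: Re_exp Im_exp)
    from k1_eq[OF z this] show ?thesis by (simp add: det_k1_matrix)
  qed
  have k2_det: "det (k2 z) = - det S_hat" if z: "z \<in> D" for z
  proof -
    \<comment> \<open>Determinants in \<open>F (\<mu> z) = S_hat ** F z ** k z\<close>, both frames
      having determinant one. Moreover \<open>det S_hat\<close> is its own inverse.\<close>
    have "det S_hat * det (k2 z) = - 1"
      using arg_cong[OF frame[OF z], of det]
      by (simp add: det_mul F_det z \<mu>D k_block[OF z] det_blockdiag k1_det)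
    then have "det S_hat * det S_hat * det (k2 z) = - det S_hat" by (simp add: mult.assoc)
    then show ?thesis using det_lorentz_square[OF O_plus_lorentz[OF assms(7)]] by simp
  qed
  have main: "Fx (\<mu> z) lam = M lam ** Fx z (inverse lam) ** blockdiag (k1 z) (k2 z)" if z: "z \<in> D"
      and lam: "lam \<in> sphere 0 1" for z lam
    unfolding M_def k_block[OF z, symmetric]
  proof (rule ext.extended_frame_antiholomorphic_symmetry[where m = "\<lambda>z v. cnj (exp (L z) * v)"
      and S = S_hat])
    show "norm lam = 1" using lam by simp
  qed (use z assms(7) in \<open>simp_all add: \<mu>D d\<mu>[simplified] O_plus_lorentz k_O k_sigma frame\<close>)
  have "M \<in> twisted_loops"
    unfolding twisted_loops_def
  proof (intro CollectI conjI ballI)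
    show "continuous_on (sphere 0 1) M"
      unfolding M_def
      by (intro continuous_on_matrix_mult continuous_on_const
          ext.extended_frame_continuous_parameter \<mu>D assms(2))
    fix lam :: complex assume "lam \<in> sphere 0 1"
    then have lam: "norm lam = 1" by simp
    show "M lam \<in> O_plus (Inl 1)"
      unfolding M_def by (intro O_plus_mult O_plus_inv k_O ext.extended_frame_O_plus lam \<mu>D
          assms(2))
    show "sigma (M lam) = M (- lam)"
      unfolding M_def sigma_mult sigma_lorentz_inv
      by (simp add: ext.sigma_extended_frame[OF lam] \<mu>D assms(2) k_sigma)
  qed
  moreover have "S_hat = M 1"
  proof -
    \<comment> \<open>The two descriptions of \<open>Fx z0 1\<close> give
      \<open>F z0 = mat 1\<close>, so the symmetry relation at \<open>z0\<close> becomes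
      \<open>F (\<mu> z0) = S_hat ** k z0\<close>.\<close>
    have "Fx z0 1 = F z0" "Fx z0 1 = mat 1" and "Fx (\<mu> z0) 1 = F (\<mu> z0)"
      using assms(2,10) \<mu>D by (auto simp: extended_frame_def)
    then have "F z0 = mat 1" and "Fx (\<mu> z0) 1 = F (\<mu> z0)" by simp_all
    then have "Fx (\<mu> z0) 1 = S_hat ** k z0" using frame[OF assms(2)] by simp
    then show ?thesis by (simp add: M_def
        lorentz_matrix_cancel_right[OF O_plus_lorentz[OF k_O[OF assms(2)]]])
  qed
  moreover have "k1 z \<in> O_plus 1" "orthogonal_matrix (k2 z)" if z: "z \<in> D" for z
  proof -
    show "k1 z \<in> O_plus 1"
    proof (rule blockdiag_O_plus_imp)
      show "blockdiag (k1 z) (k2 z) \<in> O_plus (Inl 1)" using k_O[OF z] by (simp only: k_block[OF z])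
      show "lorentz_matrix 1 (k1 z)" unfolding k1_def k_def by (rule sym.transition_block(2)[OF z])
    qed
    show "orthogonal_matrix (k2 z)" unfolding k2_def k_def by (rule sym.transition_block(3)[OF z])
  qed
  moreover have "k1 z = k1_matrix (\<tau> z) (\<theta> z)
          (- Re (complex_of_real (sqrt 2) * d_z (\<lambda>p. complex_of_real (\<tau> p)) z))
          (Im (complex_of_real (sqrt 2) * d_z (\<lambda>p. complex_of_real (\<tau> p)) z))"
    if \<tau>\<theta>: "\<forall>z\<in>D. d_zbar \<mu> z = exp (complex_of_real (\<tau> z) + \<i> * complex_of_real (\<theta> z))"
        and z: "z \<in> D"
    for \<tau> \<theta> :: "complex \<Rightarrow> real" and z
  proof -
    have e: "cnj (exp (L p)) = exp (complex_of_real (\<tau> p) + \<i> * complex_of_real (\<theta> p))" if "p \<in> D"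
        for p
      using \<tau>\<theta> d_zbar_antiholomorphic[OF d\<mu>[OF that]] that by simp
    \<comment> \<open>Since \<open>\<tau>\<close> gets differentiated, it is identified with
      \<open>Re L\<close> on all of \<open>D\<close>. The angle enters \<open>k1_matrix\<close> only
      through its cosine and sine, so a shift by a multiple of a full turn is harmless.\<close>
    have "\<tau> p = Re (L p)" if "p \<in> D" for p
    proof -
      have "norm (cnj (exp (L p))) = norm (exp (complex_of_real (\<tau> p) + \<i> * complex_of_real (\<theta> p)))"
        using e[OF that] by simp
      then show ?thesis by (simp add: norm_exp_eq_Re)
    qed
    from d_z_Re_holomorphic[OF D(1) z sym.L_has_derivative[OF z] this]
    have dz: "d_z (\<lambda>p. complex_of_real (\<tau> p)) z = deriv L z / 2" .
    have half: "sqrt 2 * x / 2 = x / sqrt 2" for x :: real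
      by (simp add: field_simps)
    show ?thesis unfolding k1_eq[OF z e[OF z]] dz by (simp add: half)
  qed
  \<comment> \<open>The block \<open>k2\<close> acts on the last columns only; \<open>k1\<close>
    changes the basis of the span by a matrix of determinant \<open>- 1\<close> and so reverses the
    orientation.\<close>
  moreover have "mod_K (Fx (\<mu> z) lam) = act_oriented (M lam)
      (reverse_orientation (mod_K (Fx z (inverse lam))))"
    if "z \<in> D" "lam \<in> sphere 0 1" for z lam
    unfolding mod_K_def main[OF that] first_four_blockdiag unfolding first_four_mult
    by (rule oriented_span_negative) (simp add: k1_det[OF that(1)])
  ultimately show ?thesis
    using main k1_det k2_det by (intro exI[of _ M] exI[of _ k1] exI[of _ k2]) blast
qed

end
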